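(* Let $\varepsilon\in\{1,-1\}$. Breather solutions $u$ of the derivative nonlinear Schrödinger equation $$iu_t+u_{xx}-i\varepsilon(|u|^2u)_x=0,\qquad (t,x)\in\mathbb{R}\times\mathbb{R},$$ cannot exist in any of the following regimes: (1) $\varepsilon=-1$ and $H[u]\le0$; (2) $\varepsilon=1$ and $H[u]\ge0$.
   Context: $H$ is the conserved quantity $$H[u]=\int_{\mathbb{R}}\Big(\tfrac i2(\bar uu_x-u\bar u_x)+\tfrac{\varepsilon}{2}|u|^4\Big)dx=-\mathrm{Im}\int_{\mathbb{R}}\bar uu_x\,dx+\tfrac{\varepsilon}{2}\int_{\mathbb{R}}|u|^4dx .$$ Breather (in the weak sense, which includes standing waves): a solution $u:\mathbb{R}\times\mathbb{R}\to\mathbb{C}$, not identically zero, for which there exist $\tau,C,\gamma>0$ and $\alpha^*\ge0$ such that: (i) $u(t+\tau,x)=u(t,x)$ for all $(t,x)\in\mathbb{R}\times\mathbb{R}$; (ii) $u(t,\cdot)\in C^\infty(\mathbb{R})\cap H^1(\mathbb{R})$ for all $t\in\mathbb{R}$; (iii) $\sup_{t\in\mathbb{R}}|\partial_x^\alpha u(t,x)|\le Ce^{-\gamma|x|}$ for all $x\in\mathbb{R}$ and all integers $0\le\alpha\le\alpha^*$. *)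

theory Defs
  imports "HOL-Analysis.Analysis"
begin

text \<open>
  A function \<open>u : \<real> \<times> \<real> \<rightarrow> \<complex>\<close> is curried, time first: \<open>u t x\<close>, so \<open>u t\<close> is the profile at time \<open>t\<close>.
\<close>

definition Dx :: "(real \<Rightarrow> complex) \<Rightarrow> real \<Rightarrow> complex" where
  "Dx f = (\<lambda>x. vector_derivative f (at x))"

definition smooth :: "(real \<Rightarrow> complex) \<Rightarrow> bool" where
  "smooth f \<longleftrightarrow> (\<forall>k x. (Dx ^^ k) f differentiable (at x))"

definition square_integrable :: "(real \<Rightarrow> complex) \<Rightarrow> bool" where
  "square_integrable f \<longleftrightarrow> f \<in> borel_measurable lborel \<and> integrable lborel (\<lambda>x. (cmod (f x))\<^sup>2)"

text \<open>
  The space \<open>C\<^sup>\<infinity>(\<real>) \<inter> H\<^sup>1(\<real>)\<close>: the weak derivative of a smooth function is its classical one.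
\<close>

definition smooth_H1 :: "(real \<Rightarrow> complex) set" where
  "smooth_H1 = {f. smooth f \<and> square_integrable f \<and> square_integrable (Dx f)}"

definition H1_norm :: "(real \<Rightarrow> complex) \<Rightarrow> real" where
  "H1_norm f = sqrt (LINT x|lborel. (cmod (f x))\<^sup>2 + (cmod (Dx f x))\<^sup>2)"

definition test_function :: "(real \<Rightarrow> complex) \<Rightarrow> bool" where
  "test_function \<phi> \<longleftrightarrow> smooth \<phi> \<and> bounded {x. \<phi> x \<noteq> 0}"

text \<open>
  Solutions of \<open>i u\<^sub>t + u\<^sub>x\<^sub>x - i \<epsilon> (|u|\<^sup>2 u)\<^sub>x = 0\<close> are taken in \<open>C(\<real>; H\<^sup>1(\<real>))\<close>, the class in which
  the energy is conserved.  Their profiles are smooth, so the space derivatives are classical;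
  the time derivative is taken in the sense of distributions in \<open>x\<close>, i.e. \<open>\<langle>u\<^sub>t(t), \<phi>\<rangle>\<close> is the
  derivative at \<open>t\<close> of \<open>s \<mapsto> \<integral> u(s,x) \<phi>(x) dx\<close>.
\<close>

definition dnls_solution :: "real \<Rightarrow> (real \<Rightarrow> real \<Rightarrow> complex) \<Rightarrow> bool" where
  "dnls_solution \<epsilon> u \<longleftrightarrow>
     (\<forall>t. u t \<in> smooth_H1) \<and>
     (\<forall>t. ((\<lambda>s. H1_norm (\<lambda>x. u s x - u t x)) \<longlongrightarrow> 0) (at t)) \<and>
     (\<forall>\<phi> t. test_function \<phi> \<longrightarrow>
        (\<exists>d. ((\<lambda>s. LINT x|lborel. u s x * \<phi> x) has_vector_derivative d) (at t) \<and>
             \<i> * d + (LINT x|lborel.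
                (Dx (Dx (u t)) x
                  - \<i> * complex_of_real \<epsilon> * Dx (\<lambda>y. complex_of_real ((cmod (u t y))\<^sup>2) * u t y) x)
                * \<phi> x) = 0))"

definition dnls_energy :: "real \<Rightarrow> (real \<Rightarrow> complex) \<Rightarrow> real" where
  "dnls_energy \<epsilon> v =
     - Im (LINT x|lborel. cnj (v x) * Dx v x) + \<epsilon> / 2 * (LINT x|lborel. (cmod (v x)) ^ 4)"

definition dnls_breather :: "real \<Rightarrow> (real \<Rightarrow> real \<Rightarrow> complex) \<Rightarrow> bool" where
  "dnls_breather \<epsilon> u \<longleftrightarrow>
     dnls_solution \<epsilon> u \<and>
     (\<exists>t x. u t x \<noteq> 0) \<and>
     (\<exists>\<tau> C \<gamma> :: real. \<exists>\<alpha>max :: nat.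
        \<tau> > 0 \<and> C > 0 \<and> \<gamma> > 0 \<and>
        (\<forall>t x. u (t + \<tau>) x = u t x) \<and>
        (\<forall>t. u t \<in> smooth_H1) \<and>
        (\<forall>\<alpha>\<le>\<alpha>max. \<forall>t x. cmod ((Dx ^^ \<alpha>) (u t) x) \<le> C * exp (- \<gamma> * \<bar>x\<bar>)))"

end

theory Submission imports Defs begin

text \<open>
  With \<open>G = i u\<^sub>x + \<epsilon>|u|\<^sup>2u\<close> the equation reads \<open>u\<^sub>t = \<partial>\<^sub>x G\<close>, and the energy density has variational
  derivative \<open>2G\<close>, which is why the energy is conserved.  The centre of mass satisfies
  \<open>d/dt \<integral> x|u|\<^sup>2 = \<integral> (2 Im(cnj u u\<^sub>x) - (3\<epsilon>/2)|u|\<^sup>4) = -2 H[u] - (\<epsilon>/2) \<integral> |u|\<^sup>4\<close>.  Over a period the left-hand side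
  integrates to zero, while for \<open>\<epsilon> H[u] \<ge> 0\<close> the right-hand side has a fixed sign and vanishes
  only for \<open>u = 0\<close>.

  Profiles are only known to lie in \<open>H\<^sup>1\<close>, with \<open>u\<^sub>t\<close> in \<open>H\<^sup>-\<^sup>1\<close>, so neither computation is legitimate as
  it stands.  In the energy the derivative is replaced by a symmetric difference quotient \<open>D\<close>; the
  time derivative of the regularised energy is then
  \<open>-2 Re i \<integral> (D N - N\<^sub>x) cnj u\<^sub>x\<close> with \<open>N = \<epsilon>|u|\<^sup>2u\<close>, which tends to zero because \<open>D N\<close> converges weakly
  to \<open>N\<^sub>x\<close> in \<open>L\<^sup>2\<close>.  In the centre of mass the weight \<open>x\<close> is replaced by \<open>x b(x/n)\<close> for a bump
  function \<open>b\<close>.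
\<close>

section \<open>Smooth functions and a bump function\<close>


text \<open>Since u_t pairs only with H^1 functions, a functional of u cannot be differentiated by
  expanding it and discarding second-order terms. \<open>functional_derivative\<close> is the one
  chain rule: it asks for an exact identity F(s) - F(t) = Re \<integral> (u(s) - u(t)) \<Phi>(s)
  with \<Phi> continuous into H^1 at t, so no remainder has to be estimated. A test function that
  moves with s is harmless because the error in the equation is controlled by the L^2 norm of its
  derivative alone. For the true energy \<Phi> would contain u_x, which is not controlled in H^1;
  hence the difference quotient. It has to be the symmetric one: being skew like \<partial>_x and
  commuting with conjugation, it makes the dispersive contribution vanish identically and leaves
  only a nonlinear defect. Both regularisations are removed after integration in time, so neither
  the energy nor the centre of mass is itself differentiated. Conservation enters because the sign
  of H is assumed at a single time only.\<close>

primrec differentiable_upto :: "nat \<Rightarrow> (real \<Rightarrow> complex) \<Rightarrow> bool" where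
  "differentiable_upto 0 f \<longleftrightarrow> True"
| "differentiable_upto (Suc n) f \<longleftrightarrow> (\<forall>x. f differentiable (at x)) \<and> differentiable_upto n (Dx f)"

text \<open>\<open>smooth\<close> quantifies over iterates of \<open>Dx\<close> and offers no
  induction. Peeling one \<open>Dx\<close> off the argument turns the closure properties into
  inductions on the order, with the functions arbitrary because the product rule changes
  them.\<close>

lemma differentiable_upto_iff:
  "differentiable_upto n f \<longleftrightarrow> (\<forall>k<n. \<forall>x. (Dx ^^ k) f differentiable (at x))"
proof (induction n arbitrary: f)
  case (Suc n)
  have "(\<forall>k<Suc n. \<forall>x. (Dx ^^ k) f differentiable (at x)) \<longleftrightarrow>
     (\<forall>x. f differentiable (at x)) \<and> (\<forall>k<n. \<forall>x. (Dx ^^ Suc k) f differentiable (at x))"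
    by (auto simp: less_Suc_eq_0_disj)
  then show ?case using Suc by (simp add: funpow_swap1)
qed simp

lemma smooth_iff: "smooth f \<longleftrightarrow> (\<forall>n. differentiable_upto n f)"
  unfolding smooth_def differentiable_upto_iff by blast

lemma Dx_eqI: "(f has_vector_derivative d) (at x) \<Longrightarrow> Dx f x = d"
  by (simp add: Dx_def vector_derivative_at)

lemma Dx_works: "f differentiable (at x) \<Longrightarrow> (f has_vector_derivative Dx f x) (at x)"
  by (simp add: Dx_def vector_derivative_works)

lemma has_vector_derivative_differentiable:
  "(f has_vector_derivative d) (at x) \<Longrightarrow> f differentiable (at x)"
  by (auto simp: has_vector_derivative_def differentiable_def)

lemma Dx_const: "Dx (\<lambda>x. c) = (\<lambda>x. 0)"
  by (auto intro!: Dx_eqI derivative_eq_intros)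

lemma differentiable_upto_const: "differentiable_upto n (\<lambda>x. c)"
  by (induction n arbitrary: c) (auto simp: Dx_const)

lemma differentiable_upto_mono: "differentiable_upto n f \<Longrightarrow> m \<le> n \<Longrightarrow> differentiable_upto m f"
  unfolding differentiable_upto_iff by simp

lemma differentiable_upto_add:
  "differentiable_upto n f \<Longrightarrow> differentiable_upto n g \<Longrightarrow> differentiable_upto n (\<lambda>x. f x + g x)"
proof (induction n arbitrary: f g)
  case (Suc n)
  then have "Dx (\<lambda>x. f x + g x) = (\<lambda>x. Dx f x + Dx g x)"
    by (intro ext Dx_eqI has_vector_derivative_add) (auto intro: Dx_works)
  with Suc show ?case by simp
qed simp

lemma differentiable_upto_mult:
  "differentiable_upto n f \<Longrightarrow> differentiable_upto n g \<Longrightarrow> differentiable_upto n (\<lambda>x. f x * g x)"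
proof (induction n arbitrary: f g)
  case (Suc n)
  then have "Dx (\<lambda>x. f x * g x) = (\<lambda>x. f x * Dx g x + Dx f x * g x)"
    by (intro ext Dx_eqI has_vector_derivative_mult) (auto intro: Dx_works)
  moreover have "differentiable_upto n f" "differentiable_upto n g"
    using Suc.prems by (auto intro: differentiable_upto_mono[of "Suc n"] simp del: differentiable_upto.simps)
  ultimately show ?case using Suc by (auto intro: differentiable_upto_add)
qed simp

lemma differentiable_upto_cnj: "differentiable_upto n f \<Longrightarrow> differentiable_upto n (\<lambda>x. cnj (f x))"
proof (induction n arbitrary: f)
  case (Suc n)
  have *: "((\<lambda>x. cnj (f x)) has_vector_derivative cnj (Dx f x)) (at x)" for x
    using Suc by (auto intro!: bounded_linear.has_vector_derivative[OF bounded_linear_cnj] Dx_works)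
  then have "Dx (\<lambda>x. cnj (f x)) = (\<lambda>x. cnj (Dx f x))"
    by (intro ext Dx_eqI)
  with Suc * show ?case by (auto intro: has_vector_derivative_differentiable)
qed simp

lemma has_vector_derivative_affine:
  fixes f :: "real \<Rightarrow> 'a::real_normed_vector"
  assumes "(f has_vector_derivative d) (at (a + b * x))"
  shows "((\<lambda>x. f (a + b * x)) has_vector_derivative b *\<^sub>R d) (at x)"
proof -
  have "((\<lambda>x. a + b * x) has_vector_derivative b) (at x)"
    by (auto intro!: derivative_eq_intros simp flip: has_real_derivative_iff_has_vector_derivative)
  from vector_diff_chain_at[OF this assms] show ?thesis by (simp add: o_def)
qed

lemma differentiable_upto_affine:
  "differentiable_upto n f \<Longrightarrow> differentiable_upto n (\<lambda>x. f (a + b * x))"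
proof (induction n arbitrary: f)
  case (Suc n)
  have *: "((\<lambda>x. f (a + b * x)) has_vector_derivative of_real b * Dx f (a + b * x)) (at x)" for x
    using has_vector_derivative_affine[OF Dx_works, of f a b x] Suc by (simp add: scaleR_conv_of_real)
  then have "Dx (\<lambda>x. f (a + b * x)) = (\<lambda>x. of_real b * Dx f (a + b * x))"
    by (intro ext Dx_eqI)
  with Suc * show ?case
    by (auto intro: has_vector_derivative_differentiable differentiable_upto_mult differentiable_upto_const)
qed simp

lemma smooth_const: "smooth (\<lambda>x. c)"
  and smooth_add: "smooth f \<Longrightarrow> smooth g \<Longrightarrow> smooth (\<lambda>x. f x + g x)"
  and smooth_mult: "smooth f \<Longrightarrow> smooth g \<Longrightarrow> smooth (\<lambda>x. f x * g x)"
  and smooth_cnj: "smooth f \<Longrightarrow> smooth (\<lambda>x. cnj (f x))"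
  and smooth_affine: "smooth f \<Longrightarrow> smooth (\<lambda>x. f (a + b * x))"
  unfolding smooth_iff
  by (auto intro: differentiable_upto_const differentiable_upto_add differentiable_upto_mult
      differentiable_upto_cnj differentiable_upto_affine)

lemma smooth_diff: "smooth f \<Longrightarrow> smooth g \<Longrightarrow> smooth (\<lambda>x. f x - g x)"
  using smooth_add[OF _ smooth_mult[OF smooth_const[of "-1"]], of f g] by simp

lemma smooth_Dx: "smooth f \<Longrightarrow> smooth (Dx f)"
  unfolding smooth_iff using differentiable_upto.simps(2) by blast

lemma smooth_has_derivative: "smooth f \<Longrightarrow> (f has_vector_derivative Dx f x) (at x)"
  unfolding smooth_def by (rule Dx_works) (metis funpow_0)

lemma smooth_of_real: "smooth (\<lambda>x. complex_of_real x)"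
proof -
  have *: "((\<lambda>x. complex_of_real x) has_vector_derivative 1) (at x)" for x
    using bounded_linear.has_vector_derivative[OF bounded_linear_of_real has_vector_derivative_id] by simp
  then have "Dx (\<lambda>x. complex_of_real x) = (\<lambda>x. 1)"
    by (intro ext Dx_eqI)
  then have "differentiable_upto n (\<lambda>x. complex_of_real x)" for n
    using * by (cases n) (auto intro: differentiable_upto_const has_vector_derivative_differentiable)
  then show ?thesis by (simp add: smooth_iff)
qed

lemma smooth_continuous: "smooth f \<Longrightarrow> continuous_on A f"
  by (meson continuous_at_imp_continuous_on has_vector_derivative_continuous smooth_has_derivative)

lemma smooth_borel: "smooth f \<Longrightarrow> f \<in> borel_measurable borel"
  by (intro borel_measurable_continuous_onI smooth_continuous)

lemma Dx_rules:
  assumes "smooth f"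
  shows Dx_add: "smooth g \<Longrightarrow> Dx (\<lambda>x. f x + g x) = (\<lambda>x. Dx f x + Dx g x)"
    and Dx_diff: "smooth g \<Longrightarrow> Dx (\<lambda>x. f x - g x) = (\<lambda>x. Dx f x - Dx g x)"
    and Dx_mult: "smooth g \<Longrightarrow> Dx (\<lambda>x. f x * g x) = (\<lambda>x. f x * Dx g x + Dx f x * g x)"
    and Dx_cmult: "Dx (\<lambda>x. c * f x) = (\<lambda>x. c * Dx f x)"
    and Dx_cnj: "Dx (\<lambda>x. cnj (f x)) = (\<lambda>x. cnj (Dx f x))"
    and Dx_affine: "Dx (\<lambda>x. f (a + b * x)) = (\<lambda>x. of_real b * Dx f (a + b * x))"
proof -
  note D = smooth_has_derivative[OF assms]
  show "Dx (\<lambda>x. f x + g x) = (\<lambda>x. Dx f x + Dx g x)" "Dx (\<lambda>x. f x - g x) = (\<lambda>x. Dx f x - Dx g x)"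
    "Dx (\<lambda>x. f x * g x) = (\<lambda>x. f x * Dx g x + Dx f x * g x)" if "smooth g"
    by (intro ext Dx_eqI has_vector_derivative_add has_vector_derivative_diff has_vector_derivative_mult
        D smooth_has_derivative that)+
  show "Dx (\<lambda>x. c * f x) = (\<lambda>x. c * Dx f x)" "Dx (\<lambda>x. cnj (f x)) = (\<lambda>x. cnj (Dx f x))"
    by (intro ext Dx_eqI has_vector_derivative_mult_right
        bounded_linear.has_vector_derivative[OF bounded_linear_cnj] D)+
  show "Dx (\<lambda>x. f (a + b * x)) = (\<lambda>x. of_real b * Dx f (a + b * x))"
    using has_vector_derivative_affine[OF D, of a b] by (intro ext Dx_eqI) (simp add: scaleR_conv_of_real)
qed

section \<open>A smooth function flat at the origin, and a bump\<close>

text \<open>The power of 1/x is carried along because differentiating the k-th function yields a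
  combination of those with indices k + 1 and k + 2: the family is closed under \<open>Dx\<close> up
  to linear combinations, which is what the induction for smoothness needs.\<close>

definition flat :: "nat \<Rightarrow> real \<Rightarrow> complex" where
  "flat k x = (if x > 0 then complex_of_real (inverse x ^ k * exp (- inverse x)) else 0)"

lemma flat_tendsto_0: "(flat k \<longlongrightarrow> 0) (at 0)"
proof -
  have "((\<lambda>t::real. t ^ k / exp t) \<longlongrightarrow> 0) at_top" by (rule tendsto_power_div_exp_0)
  then have "((\<lambda>x::real. inverse x ^ k / exp (inverse x)) \<longlongrightarrow> 0) (at_right 0)"
    by (rule filterlim_compose) (rule filterlim_inverse_at_top_right)
  then have "((\<lambda>x. complex_of_real (inverse x ^ k / exp (inverse x))) \<longlongrightarrow> 0) (at_right 0)"
    by (metis of_real_0 tendsto_of_real_iff)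
  then have "(flat k \<longlongrightarrow> 0) (at_right 0)"
    by (rule Lim_transform_eventually)
      (auto simp: flat_def exp_minus field_simps eventually_at_filter)
  moreover have "(flat k \<longlongrightarrow> 0) (at_left 0)"
    by (rule tendsto_eventually) (auto simp: flat_def eventually_at_filter)
  ultimately show ?thesis by (simp add: filterlim_at_split)
qed

lemma flat_has_derivative:
  "(flat k has_vector_derivative flat (k + 2) x - of_nat k * flat (Suc k) x) (at x)"
proof -
  consider "x > 0" | "x < 0" | "x = 0" by linarith
  then show ?thesis
  proof cases
    case 1
    have "((\<lambda>x. inverse x ^ k) has_real_derivative - (of_nat k * inverse x ^ Suc k)) (at x)"
      using DERIV_power[OF DERIV_inverse[of x], of k] 1 by (cases k) (simp_all add: field_simps)
    moreover have "((\<lambda>x. exp (- inverse x)) has_real_derivative inverse x ^ 2 * exp (- inverse x)) (at x)"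
      using DERIV_fun_exp[OF DERIV_minus[OF DERIV_inverse[of x]]] 1
      by (simp add: power2_eq_square mult.commute)
    ultimately have "((\<lambda>x. inverse x ^ k * exp (- inverse x)) has_real_derivative
       (inverse x ^ (k + 2) * exp (- inverse x) - of_nat k * (inverse x ^ Suc k * exp (- inverse x)))) (at x)"
      by (rule DERIV_cong[OF DERIV_mult]) (simp add: algebra_simps power_add power2_eq_square)
    then have "((\<lambda>x. complex_of_real (inverse x ^ k * exp (- inverse x))) has_vector_derivative
       of_real (inverse x ^ (k + 2) * exp (- inverse x) - of_nat k * (inverse x ^ Suc k * exp (- inverse x)))) (at x)"
      by (intro has_vector_derivative_of_real) (simp add: has_real_derivative_iff_has_vector_derivative)
    then have "((\<lambda>x. complex_of_real (inverse x ^ k * exp (- inverse x))) has_vector_derivative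
       flat (k + 2) x - of_nat k * flat (Suc k) x) (at x)"
      using 1 by (simp add: flat_def)
    then show ?thesis
      by (rule has_vector_derivative_transform_within_open[of _ _ _ "{0<..}"])
        (use 1 in \<open>auto simp: flat_def\<close>)
  next
    case 2
    have "((\<lambda>x. 0) has_vector_derivative flat (k + 2) x - of_nat k * flat (Suc k) x) (at x)"
      using 2 by (simp add: flat_def)
    then show ?thesis
      by (rule has_vector_derivative_transform_within_open[of _ _ _ "{..<0}"])
        (use 2 in \<open>auto simp: flat_def\<close>)
  next
    case 3
    \<comment> \<open>Dividing \<open>flat k\<close> by its argument gives
      \<open>flat (Suc k)\<close>, so differentiability at the origin is again
      \<open>flat_tendsto_0\<close>.\<close>
    have "((\<lambda>y. norm (flat k y) / norm y) \<longlongrightarrow> 0) (at 0)"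
      by (rule Lim_transform_eventually[OF tendsto_norm_zero[OF flat_tendsto_0[of "Suc k"]]])
        (auto simp: eventually_at_filter flat_def norm_mult norm_power norm_divide field_simps
          intro!: always_eventually)
    then show ?thesis
      using 3 by (simp add: flat_def[of _ 0] has_vector_derivative_def has_derivative_iff_norm)
  qed
qed

lemma smooth_flat: "smooth (flat k)"
proof -
  have "differentiable_upto n (flat k)" for n
  proof (induction n arbitrary: k)
    case (Suc n)
    have "Dx (flat k) = (\<lambda>x. flat (k + 2) x + (- of_nat k) * flat (Suc k) x)"
      by (intro ext Dx_eqI) (use flat_has_derivative[of k] in simp)
    then have "differentiable_upto n (Dx (flat k))"
      by (simp only:) (intro differentiable_upto_add differentiable_upto_mult differentiable_upto_const Suc)
    with flat_has_derivative[of k] show ?case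
      by (auto intro: has_vector_derivative_differentiable)
  qed simp
  then show ?thesis by (simp add: smooth_iff)
qed

text \<open>Each flat factor equals exp (-1) at the origin, so the factor exp 2 normalises the value
  there to 1.\<close>

definition bump :: "real \<Rightarrow> complex" where
  "bump x = exp 2 * flat 0 (1 + x) * flat 0 (1 - x)"

lemma smooth_bump: "smooth bump"
  unfolding bump_def[abs_def]
  using smooth_affine[OF smooth_flat, of 0 1 1] smooth_affine[OF smooth_flat, of 0 1 "-1"]
  by (auto intro!: smooth_mult smooth_const)

lemma bump_0: "bump 0 = 1"
  by (simp add: bump_def flat_def flip: exp_add exp_of_real)

lemma bump_eq_0: "\<bar>x\<bar> \<ge> 1 \<Longrightarrow> bump x = 0"
  by (auto simp: bump_def flat_def)

section \<open>The space \<open>L\<^sup>2(\<real>)\<close>\<close>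


definition L2norm :: "(real \<Rightarrow> complex) \<Rightarrow> real" where
  "L2norm f = sqrt (LINT x|lborel. (cmod (f x))\<^sup>2)"

lemma L2norm_nonneg [simp]: "0 \<le> L2norm f"
  by (simp add: L2norm_def)

lemma L2norm_power2: "(L2norm f)\<^sup>2 = (LINT x|lborel. (cmod (f x))\<^sup>2)"
  by (simp add: L2norm_def)

lemma square_integrable_borel [measurable_dest]:
  "square_integrable f \<Longrightarrow> f \<in> borel_measurable borel"
  by (simp add: square_integrable_def)

lemma square_integrable_dominated:
  assumes "square_integrable g" "f \<in> borel_measurable borel" "\<And>x. cmod (f x) \<le> B * cmod (g x)"
  shows "square_integrable f" and "0 \<le> B \<Longrightarrow> L2norm f \<le> B * L2norm g"
proof -
  have *: "(cmod (f x))\<^sup>2 \<le> B\<^sup>2 * (cmod (g x))\<^sup>2" for x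
    using power_mono[OF assms(3)[of x], of 2] by (simp add: power_mult_distrib)
  have int: "integrable lborel (\<lambda>x. B\<^sup>2 * (cmod (g x))\<^sup>2)"
    using assms(1) by (simp add: square_integrable_def)
  have int_f: "integrable lborel (\<lambda>x. (cmod (f x))\<^sup>2)"
    by (rule Bochner_Integration.integrable_bound[OF int]) (use assms(2) * in auto)
  then show "square_integrable f" using assms(2) by (simp add: square_integrable_def)
  assume "0 \<le> B"
  have "(L2norm f)\<^sup>2 \<le> (LINT x|lborel. B\<^sup>2 * (cmod (g x))\<^sup>2)"
    unfolding L2norm_power2 using int_f int * by (rule integral_mono)
  also have "\<dots> = (B * L2norm g)\<^sup>2"
    by (simp add: L2norm_power2 power_mult_distrib)
  finally show "L2norm f \<le> B * L2norm g"
    by (rule power2_le_imp_le) (simp add: \<open>0 \<le> B\<close>)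
qed

lemma square_integrable_cmult: "square_integrable f \<Longrightarrow> square_integrable (\<lambda>x. c * f x)"
  by (rule square_integrable_dominated[of f _ "cmod c"]) (auto simp: norm_mult)

lemma square_integrable_cnj: "square_integrable f \<Longrightarrow> square_integrable (\<lambda>x. cnj (f x))"
  by (simp add: square_integrable_def borel_measurable_continuous_on
      [OF linear_continuous_on[OF bounded_linear_cnj]])

lemma square_integrable_add:
  assumes "square_integrable f" "square_integrable g"
  shows "square_integrable (\<lambda>x. f x + g x)"
proof -
  note [measurable] = assms
  have int: "integrable lborel (\<lambda>x. 2 * (cmod (f x))\<^sup>2 + 2 * (cmod (g x))\<^sup>2)"
    using assms by (simp add: square_integrable_def)
  have "(cmod (f x + g x))\<^sup>2 \<le> 2 * (cmod (f x))\<^sup>2 + 2 * (cmod (g x))\<^sup>2" for x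
  proof -
    have "(cmod (f x + g x))\<^sup>2 \<le> (cmod (f x) + cmod (g x))\<^sup>2"
      by (intro power_mono norm_triangle_ineq) auto
    then show ?thesis using sum_squares_bound[of "cmod (f x)" "cmod (g x)"]
      by (simp add: power2_sum)
  qed
  then have "integrable lborel (\<lambda>x. (cmod (f x + g x))\<^sup>2)"
    by (intro Bochner_Integration.integrable_bound[OF int]) auto
  then show ?thesis by (simp add: square_integrable_def)
qed

lemma square_integrable_diff:
  "square_integrable f \<Longrightarrow> square_integrable g \<Longrightarrow> square_integrable (\<lambda>x. f x - g x)"
  using square_integrable_add[OF _ square_integrable_cmult[of g "-1"], of f] by simp

lemma square_integrable_bounded_mult:
  assumes "square_integrable g" "f \<in> borel_measurable borel" "\<And>x. cmod (f x) \<le> B"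
  shows "square_integrable (\<lambda>x. f x * g x)" and "L2norm (\<lambda>x. f x * g x) \<le> B * L2norm g"
proof -
  note [measurable] = assms(1,2)
  have "0 \<le> B" using assms(3)[of 0] norm_ge_zero order_trans by blast
  have "cmod (f x * g x) \<le> B * cmod (g x)" for x
    by (simp add: norm_mult assms mult_right_mono)
  from square_integrable_dominated[OF assms(1) _ this] \<open>0 \<le> B\<close>
  show "square_integrable (\<lambda>x. f x * g x)" "L2norm (\<lambda>x. f x * g x) \<le> B * L2norm g" by auto
qed

lemma integrable_mult_cmod:
  assumes "square_integrable f" "square_integrable g"
  shows "integrable lborel (\<lambda>x. cmod (f x) * cmod (g x))"
proof -
  note [measurable] = assms
  have int: "integrable lborel (\<lambda>x. (cmod (f x))\<^sup>2 + (cmod (g x))\<^sup>2)"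
    using assms by (simp add: square_integrable_def)
  have "cmod (f x) * cmod (g x) \<le> (cmod (f x))\<^sup>2 + (cmod (g x))\<^sup>2" for x
    using sum_squares_bound[of "cmod (f x)" "cmod (g x)"]
      mult_nonneg_nonneg[OF norm_ge_zero norm_ge_zero, of "f x" "g x"] by linarith
  then show ?thesis
    by (intro Bochner_Integration.integrable_bound[OF int]) auto
qed

lemma integrable_mult_L2:
  assumes "square_integrable f" "square_integrable g"
  shows "integrable lborel (\<lambda>x. f x * g x)"
  by (rule Bochner_Integration.integrable_bound[OF integrable_mult_cmod[OF assms]])
    (use assms in \<open>auto simp: norm_mult\<close>)

lemma Cauchy_Schwarz_cmod:
  assumes "square_integrable f" "square_integrable g"
  shows "(LINT x|lborel. cmod (f x) * cmod (g x)) \<le> L2norm f * L2norm g"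
proof (cases "L2norm f = 0 \<or> L2norm g = 0")
  case True
  have *: "AE x in lborel. f x = 0" if "square_integrable f" "L2norm f = 0" for f :: "real \<Rightarrow> complex"
  proof -
    have "(LINT x|lborel. (cmod (f x))\<^sup>2) = 0" using that by (simp add: L2norm_def)
    then have "AE x in lborel. (cmod (f x))\<^sup>2 = 0"
      using that by (subst (asm) integral_nonneg_eq_0_iff_AE) (auto simp: square_integrable_def)
    then show ?thesis by simp
  qed
  have "AE x in lborel. cmod (f x) * cmod (g x) = 0"
    using True *[OF assms(1)] *[OF assms(2)] by auto
  then have "(LINT x|lborel. cmod (f x) * cmod (g x)) = 0"
    by (rule integral_eq_zero_AE)
  then show ?thesis by simp
next
  case False
  define a b where "a = L2norm f" and "b = L2norm g"
  have pos: "a > 0" "b > 0" using False by (auto simp: a_def b_def less_le)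
  \<comment> \<open>Young's inequality, weighted so that each square integrates to a * b / 2. The
    weights divide by both norms, hence the separate case of a zero norm.\<close>
  have int: "integrable lborel (\<lambda>x. (cmod (f x))\<^sup>2 * (b / a / 2) + (cmod (g x))\<^sup>2 * (a / b / 2))"
    using assms by (intro Bochner_Integration.integrable_add integrable_mult_left)
      (auto simp: square_integrable_def)
  have "cmod (f x) * cmod (g x) \<le> (cmod (f x))\<^sup>2 * (b / a / 2) + (cmod (g x))\<^sup>2 * (a / b / 2)" for x
  proof -
    have "2 * (b * cmod (f x)) * (a * cmod (g x)) \<le> (b * cmod (f x))\<^sup>2 + (a * cmod (g x))\<^sup>2"
      by (rule sum_squares_bound)
    then show ?thesis using pos by (simp add: field_simps power2_eq_square)
  qed
  then have "(LINT x|lborel. cmod (f x) * cmod (g x)) \<le>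
      (LINT x|lborel. (cmod (f x))\<^sup>2 * (b / a / 2) + (cmod (g x))\<^sup>2 * (a / b / 2))"
    by (intro integral_mono integrable_mult_cmod assms int)
  also have "\<dots> = a\<^sup>2 * (b / a / 2) + b\<^sup>2 * (a / b / 2)"
    using assms unfolding a_def b_def L2norm_power2
    by (subst Bochner_Integration.integral_add) (auto simp: square_integrable_def)
  also have "\<dots> = a * b" using pos by (simp add: field_simps power2_eq_square)
  finally show ?thesis by (simp add: a_def b_def)
qed

lemma Cauchy_Schwarz_L2:
  assumes "square_integrable f" "square_integrable g"
  shows "cmod (LINT x|lborel. f x * g x) \<le> L2norm f * L2norm g"
  using integral_norm_bound[of lborel "\<lambda>x. f x * g x"] Cauchy_Schwarz_cmod[OF assms]
  by (simp add: norm_mult)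

lemma L2norm_triangle:
  assumes "square_integrable f" "square_integrable g"
  shows "L2norm (\<lambda>x. f x + g x) \<le> L2norm f + L2norm g"
proof -
  have int: "integrable lborel (\<lambda>x. (cmod (f x))\<^sup>2)" "integrable lborel (\<lambda>x. (cmod (g x))\<^sup>2)"
    using assms by (auto simp: square_integrable_def)
  note int' = integrable_mult_cmod[OF assms]
  have "(L2norm (\<lambda>x. f x + g x))\<^sup>2 \<le>
      (LINT x|lborel. (cmod (f x))\<^sup>2 + (cmod (g x))\<^sup>2 + 2 * (cmod (f x) * cmod (g x)))"
    unfolding L2norm_power2
  proof (rule integral_mono)
    show "integrable lborel (\<lambda>x. (cmod (f x + g x))\<^sup>2)"
      using square_integrable_add[OF assms] by (simp add: square_integrable_def)
    show "(cmod (f x + g x))\<^sup>2 \<le> (cmod (f x))\<^sup>2 + (cmod (g x))\<^sup>2 + 2 * (cmod (f x) * cmod (g x))" for x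
      using power_mono[OF norm_triangle_ineq[of "f x" "g x"], of 2] by (simp add: power2_sum algebra_simps)
  qed (use int int' in auto)
  also have "\<dots> = (L2norm f)\<^sup>2 + (L2norm g)\<^sup>2 + 2 * (LINT x|lborel. cmod (f x) * cmod (g x))"
    using int int' by (simp add: L2norm_power2)
  also have "\<dots> \<le> (L2norm f + L2norm g)\<^sup>2"
    using Cauchy_Schwarz_cmod[OF assms] by (simp add: power2_sum)
  finally show ?thesis by (rule power2_le_imp_le) simp
qed

lemma L2norm_minus: "L2norm (\<lambda>x. - f x) = L2norm f"
  and L2norm_cnj: "L2norm (\<lambda>x. cnj (f x)) = L2norm f"
  and L2norm_cmult: "L2norm (\<lambda>x. c * f x) = cmod c * L2norm f"
  by (simp_all add: L2norm_def norm_mult power_mult_distrib real_sqrt_mult)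

lemma L2norm_minus_commute: "L2norm (\<lambda>x. f x - g x) = L2norm (\<lambda>x. g x - f x)"
  by (simp add: L2norm_def norm_minus_commute)

lemma L2norm_diff_triangle:
  assumes "square_integrable f" "square_integrable g"
  shows "\<bar>L2norm f - L2norm g\<bar> \<le> L2norm (\<lambda>x. f x - g x)"
  using L2norm_triangle[OF square_integrable_diff[OF assms] assms(2)]
    L2norm_triangle[OF square_integrable_diff[OF assms(2,1)] assms(1)]
    L2norm_minus_commute[of f g] by simp

lemma square_integrable_shift:
  "square_integrable f \<Longrightarrow> square_integrable (\<lambda>x. f (d + x))"
  using lborel_integrable_real_affine[of "\<lambda>x. (cmod (f x))\<^sup>2" 1 d]
  by (auto simp: square_integrable_def)

lemma integral_shift:
  fixes f :: "real \<Rightarrow> 'a::{banach, second_countable_topology}"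
  shows "(LINT x|lborel. f (d + x)) = (LINT x|lborel. f x)"
  using lborel_integral_real_affine[of 1 f d] by simp

lemma L2norm_shift: "L2norm (\<lambda>x. f (d + x)) = L2norm f"
  unfolding L2norm_def using integral_shift[of "\<lambda>x. (cmod (f x))\<^sup>2" d] by simp

lemma L2norm_dominated_convergence:
  assumes "square_integrable g" "\<And>n. f n \<in> borel_measurable borel" "\<And>n x. cmod (f n x) \<le> cmod (g x)"
    and "\<And>x. (\<lambda>n. f n x) \<longlonglongrightarrow> 0"
  shows "(\<lambda>n. L2norm (f n)) \<longlonglongrightarrow> 0"
proof -
  have "(\<lambda>n. LINT x|lborel. (cmod (f n x))\<^sup>2) \<longlonglongrightarrow> (LINT x::real|lborel. (0::real))"
  proof (rule integral_dominated_convergence)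
    show "integrable lborel (\<lambda>x. (cmod (g x))\<^sup>2)" using assms(1) by (simp add: square_integrable_def)
    show "AE x in lborel. (\<lambda>n. (cmod (f n x))\<^sup>2) \<longlonglongrightarrow> 0"
      using tendsto_power[OF tendsto_norm_zero[OF assms(4)], of _ 2] by simp
    show "AE x in lborel. norm ((cmod (f n x))\<^sup>2) \<le> (cmod (g x))\<^sup>2" for n
      using assms(3) by (simp add: power_mono)
  qed (use assms(2) in auto)
  then show ?thesis using tendsto_real_sqrt[of _ 0] by (simp add: L2norm_def)
qed

lemma integral_mult_tendsto:
  assumes "\<And>n. square_integrable (g n)" "square_integrable h" "square_integrable f"
    and "((\<lambda>n. L2norm (\<lambda>x. g n x - h x)) \<longlongrightarrow> 0) F"
  shows "((\<lambda>n. LINT x|lborel. f x * g n x) \<longlongrightarrow> (LINT x|lborel. f x * h x)) F"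
proof -
  have "((\<lambda>n. (LINT x|lborel. f x * g n x) - (LINT x|lborel. f x * h x)) \<longlongrightarrow> 0) F"
  proof (rule Lim_null_comparison)
    show "((\<lambda>n. L2norm f * L2norm (\<lambda>x. g n x - h x)) \<longlongrightarrow> 0) F"
      using tendsto_mult_left[OF assms(4)] by simp
    have "norm ((LINT x|lborel. f x * g n x) - (LINT x|lborel. f x * h x)) \<le>
        L2norm f * L2norm (\<lambda>x. g n x - h x)" for n
      using Cauchy_Schwarz_L2[OF assms(3) square_integrable_diff[OF assms(1)[of n] assms(2)]]
        integrable_mult_L2[OF assms(3) assms(1)[of n]] integrable_mult_L2[OF assms(3) assms(2)]
      by (simp add: right_diff_distrib)
    then show "\<forall>\<^sub>F n in F. norm ((LINT x|lborel. f x * g n x) - (LINT x|lborel. f x * h x)) \<le>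
        L2norm f * L2norm (\<lambda>x. g n x - h x)" by simp
  qed
  then show ?thesis by (simp add: LIM_zero_iff)
qed

section \<open>Cutoffs and the space \<open>H\<^sup>1(\<real>)\<close>\<close>


lemma compact_support_bounded:
  fixes f :: "real \<Rightarrow> complex"
  assumes "continuous_on UNIV f" "\<And>x. \<bar>x\<bar> > R \<Longrightarrow> f x = 0"
  obtains B where "\<And>x. cmod (f x) \<le> B"
proof -
  have "bounded (f ` {-R..R})"
    by (meson assms(1) compact_Icc compact_continuous_image compact_imp_bounded continuous_on_subset subset_UNIV)
  then obtain B where B: "\<And>x. x \<in> {-R..R} \<Longrightarrow> cmod (f x) \<le> B"
    unfolding bounded_iff by blast
  \<comment> \<open>B need not be nonnegative when the interval is empty; the maximum with 0 also
    covers the points where f vanishes.\<close>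
  have "cmod (f x) \<le> max B 0" for x
  proof (cases "\<bar>x\<bar> > R")
    case False
    then have "x \<in> {-R..R}" by auto
    then show ?thesis using B by (simp add: le_max_iff_disj)
  qed (use assms(2) in simp)
  with that show ?thesis by blast
qed

lemma compact_support_integrable:
  fixes f :: "real \<Rightarrow> complex"
  assumes "continuous_on UNIV f" "\<And>x. \<bar>x\<bar> > R \<Longrightarrow> f x = 0"
  shows "integrable lborel f"
proof -
  have "integrable lborel (\<lambda>x. indicator {-R..R} x *\<^sub>R f x)"
    by (intro borel_integrable_compact compact_Icc continuous_on_subset[OF assms(1)]) auto
  also have "(\<lambda>x. indicator {-R..R} x *\<^sub>R f x) = f"
    using assms(2) by (auto simp: fun_eq_iff indicator_def)
  finally show ?thesis .
qed

lemma Dx_eq_0_outside: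
  assumes "\<And>x. \<bar>x\<bar> \<ge> R \<Longrightarrow> f x = 0" "\<bar>x\<bar> > R"
  shows "Dx f x = 0"
proof (rule Dx_eqI)
  have "open {x::real. \<bar>x\<bar> > R}"
    by (intro open_Collect_less continuous_intros)
  then show "(f has_vector_derivative 0) (at x)"
    by (rule has_vector_derivative_transform_within_open[OF has_vector_derivative_const])
      (use assms in auto)
qed

lemma integral_Dx_compact_support:
  assumes "smooth f" "\<And>x. \<bar>x\<bar> \<ge> R \<Longrightarrow> f x = 0"
  shows "(LINT x|lborel. Dx f x) = 0"
proof -
  \<comment> \<open>At least 1, so that the interval is nonempty even for negative R.\<close>
  define S where "S = max R 1"
  have S: "f x = 0" if "\<bar>x\<bar> \<ge> S" for x using assms(2) that by (simp add: S_def)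
  have "(LINT x|lborel. indicator {-S..S} x *\<^sub>R Dx f x) = f S - f (-S)"
  proof (rule integral_FTC_atLeastAtMost)
    show "(f has_vector_derivative Dx f x) (at x within {-S..S})" for x
      using smooth_has_derivative[OF assms(1)] has_vector_derivative_at_within by blast
    show "continuous_on {-S..S} (Dx f)" by (intro smooth_continuous smooth_Dx assms)
  qed (simp add: S_def)
  also have "(\<lambda>x. indicator {-S..S} x *\<^sub>R Dx f x) = Dx f"
    using Dx_eq_0_outside[OF S] by (auto simp: fun_eq_iff indicator_def)
  also have "f S - f (-S) = 0" using S by simp
  finally show ?thesis .
qed

text \<open>\<open>Suc n\<close> rather than n keeps the scale finite and nonzero at n = 0.\<close>

definition cutoff :: "nat \<Rightarrow> real \<Rightarrow> complex" where
  "cutoff n x = bump (inverse (real (Suc n)) * x)"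

lemma smooth_cutoff: "smooth (cutoff n)"
  unfolding cutoff_def[abs_def] using smooth_affine[OF smooth_bump, of 0] by simp

lemma Dx_cutoff: "Dx (cutoff n) x = of_real (inverse (real (Suc n))) * Dx bump (inverse (real (Suc n)) * x)"
  using fun_cong[OF Dx_affine[OF smooth_bump, of 0 "inverse (real (Suc n))"], of x]
  by (simp add: cutoff_def[abs_def])

lemma cutoff_eq_0: "real (Suc n) \<le> \<bar>x\<bar> \<Longrightarrow> cutoff n x = 0"
  unfolding cutoff_def by (rule bump_eq_0) (simp add: abs_mult field_simps del: of_nat_Suc)

lemma bump_bounds:
  obtains B where "B \<ge> 1" "\<And>x. cmod (bump x) \<le> B" "\<And>x. cmod (Dx bump x) \<le> B"
    "\<And>x. cmod (x * Dx bump x) \<le> B"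
proof -
  have 0: "bump x = 0" "Dx bump x = 0" if "\<bar>x\<bar> > 1" for x
    using bump_eq_0 Dx_eq_0_outside[OF bump_eq_0] that by auto
  have c: "continuous_on UNIV bump" "continuous_on UNIV (Dx bump)"
    by (intro smooth_continuous smooth_Dx smooth_bump)+
  then have c': "continuous_on UNIV (\<lambda>x. complex_of_real x * Dx bump x)"
    by (intro continuous_intros)
  obtain B1 where "\<And>x. cmod (bump x) \<le> B1"
    using compact_support_bounded[OF c(1) 0(1)] by blast
  moreover obtain B2 where "\<And>x. cmod (Dx bump x) \<le> B2"
    using compact_support_bounded[OF c(2) 0(2)] by blast
  moreover obtain B3 where "\<And>x. cmod (complex_of_real x * Dx bump x) \<le> B3"
    using compact_support_bounded[OF c', of 1] 0(2) by auto
  ultimately show ?thesis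
    by (intro that[of "max 1 (max B1 (max B2 B3))"]) (auto simp: le_max_iff_disj)
qed

lemma tendsto_inverse_Suc_mult: "(\<lambda>n. inverse (real (Suc n)) * x) \<longlonglongrightarrow> 0"
  using tendsto_mult_left_zero[OF LIMSEQ_inverse_real_of_nat] by simp

lemma cutoff_tendsto: "(\<lambda>n. cutoff n x) \<longlonglongrightarrow> 1"
proof -
  have "isCont bump 0"
    using has_vector_derivative_continuous[OF smooth_has_derivative[OF smooth_bump]] .
  from isCont_tendsto_compose[OF this tendsto_inverse_Suc_mult[of x]]
  show ?thesis by (simp add: cutoff_def bump_0)
qed

text \<open>Uniformity in n of the last bound is scale invariance: with y = x / (n + 1), x times the
  derivative of \<open>cutoff n\<close> at x is y times the derivative of \<open>bump\<close> at y.
  This bound will control the derivative of the truncated weight x.\<close>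

lemma cutoff_bounds:
  obtains B where "B \<ge> 1" "\<And>n x. cmod (cutoff n x) \<le> B" "\<And>n x. cmod (Dx (cutoff n) x) \<le> B"
    "\<And>n x. cmod (x * Dx (cutoff n) x) \<le> B"
proof -
  obtain B where B: "B \<ge> 1" "\<And>x. cmod (bump x) \<le> B" "\<And>x. cmod (Dx bump x) \<le> B"
    "\<And>x. cmod (x * Dx bump x) \<le> B"
    using bump_bounds by blast
  have "cmod (Dx (cutoff n) x) \<le> 1 * B" for n x
    unfolding Dx_cutoff norm_mult
    by (rule mult_mono) (use B in \<open>auto simp: norm_inverse inverse_le_1_iff simp del: of_nat_Suc\<close>)
  moreover have "cmod (x * Dx (cutoff n) x) \<le> B" for n x
    using B(4)[of "inverse (real (Suc n)) * x"] by (simp add: Dx_cutoff mult_ac)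
  ultimately show ?thesis
    using that[of B] B by (simp add: cutoff_def)
qed

lemma Dx_cutoff_tendsto: "(\<lambda>n. Dx (cutoff n) x) \<longlonglongrightarrow> 0"
  and mult_Dx_cutoff_tendsto: "(\<lambda>n. x * Dx (cutoff n) x) \<longlonglongrightarrow> 0"
proof -
  obtain B where "B \<ge> 1" "\<And>x. cmod (bump x) \<le> B" and B: "\<And>x. cmod (Dx bump x) \<le> B"
    and "\<And>x. cmod (x * Dx bump x) \<le> B"
    using bump_bounds by blast
  show *: "(\<lambda>n. Dx (cutoff n) x) \<longlonglongrightarrow> 0"
  proof (rule Lim_null_comparison)
    show "\<forall>\<^sub>F n in sequentially. norm (Dx (cutoff n) x) \<le> inverse (real (Suc n)) * B"
      unfolding Dx_cutoff norm_mult
      by (intro always_eventually allI mult_mono) (use B in \<open>auto simp: norm_inverse simp del: of_nat_Suc\<close>)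
  qed (rule tendsto_inverse_Suc_mult)
  show "(\<lambda>n. x * Dx (cutoff n) x) \<longlonglongrightarrow> 0"
    using tendsto_mult_right_zero[OF *] by simp
qed

text \<open>With f multiplied by \<open>cutoff n\<close> the integral vanishes exactly. The error
  term, f times the derivative of the cutoff, is dominated by a multiple of |f| and tends to 0
  pointwise, so integrability does the work of a limit of f at infinity.\<close>

lemma integral_Dx_eq_0:
  assumes f: "smooth f" and int: "integrable lborel f" "integrable lborel (Dx f)"
  shows "(LINT x|lborel. Dx f x) = 0"
proof -
  obtain B where B: "B \<ge> 1" "\<And>n x. cmod (cutoff n x) \<le> B" "\<And>n x. cmod (Dx (cutoff n) x) \<le> B"
    "\<And>n x. cmod (x * Dx (cutoff n) x) \<le> B"
    using cutoff_bounds by blast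
  have [measurable]: "f \<in> borel_measurable borel" "Dx f \<in> borel_measurable borel"
    "cutoff n \<in> borel_measurable borel" "Dx (cutoff n) \<in> borel_measurable borel" for n
    by (auto intro: smooth_borel smooth_Dx f smooth_cutoff)
  have "(\<lambda>n. LINT x|lborel. cutoff n x * Dx f x + Dx (cutoff n) x * f x) \<longlonglongrightarrow> (LINT x|lborel. Dx f x)"
  proof (rule integral_dominated_convergence)
    show "integrable lborel (\<lambda>x. B * cmod (Dx f x) + B * cmod (f x))"
      using int by simp
    have "(\<lambda>n. cutoff n x * Dx f x + Dx (cutoff n) x * f x) \<longlonglongrightarrow> 1 * Dx f x + 0 * f x" for x
      by (intro tendsto_intros cutoff_tendsto Dx_cutoff_tendsto)
    then show "AE x in lborel. (\<lambda>n. cutoff n x * Dx f x + Dx (cutoff n) x * f x) \<longlonglongrightarrow> Dx f x" by simp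
    show "AE x in lborel. norm (cutoff n x * Dx f x + Dx (cutoff n) x * f x)
      \<le> B * cmod (Dx f x) + B * cmod (f x)" for n
      using B by (intro AE_I2 order_trans[OF norm_triangle_ineq] add_mono)
        (auto simp: norm_mult intro: mult_right_mono)
  qed auto
  moreover have "(LINT x|lborel. cutoff n x * Dx f x + Dx (cutoff n) x * f x) = 0" for n
    using integral_Dx_compact_support[of "\<lambda>x. cutoff n x * f x" "Suc n"]
    by (simp add: Dx_mult smooth_cutoff f smooth_mult cutoff_eq_0)
  ultimately show ?thesis by (simp add: LIMSEQ_const_iff)
qed

lemma integral_by_parts:
  assumes "smooth f" "smooth g" "square_integrable f" "square_integrable g"
    "square_integrable (Dx f)" "square_integrable (Dx g)"
  shows "(LINT x|lborel. f x * Dx g x) = - (LINT x|lborel. Dx f x * g x)"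
proof -
  note int = integrable_mult_L2[OF assms(3,4)] integrable_mult_L2[OF assms(3,6)] integrable_mult_L2[OF assms(5,4)]
  have D: "Dx (\<lambda>x. f x * g x) = (\<lambda>x. f x * Dx g x + Dx f x * g x)"
    by (rule Dx_mult[OF assms(1,2)])
  have "(LINT x|lborel. Dx (\<lambda>x. f x * g x) x) = 0"
    by (rule integral_Dx_eq_0[OF smooth_mult[OF assms(1,2)] int(1)])
      (unfold D, intro Bochner_Integration.integrable_add int)
  then have "(LINT x|lborel. f x * Dx g x) + (LINT x|lborel. Dx f x * g x) = 0"
    unfolding D Bochner_Integration.integral_add[OF int(2,3)] .
  then show ?thesis by (rule eq_neg_iff_add_eq_0[THEN iffD2])
qed

section \<open>The H^1 norm: Sobolev embedding and algebra property\<close>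

text \<open>Equivalent to \<open>H1_norm\<close>, but as a sum of two L^2 norms it inherits its
  triangle inequalities directly; \<open>u_continuous\<close> passes from one norm to the
  other.\<close>

definition H1norm :: "(real \<Rightarrow> complex) \<Rightarrow> real" where
  "H1norm f = L2norm f + L2norm (Dx f)"

lemma H1norm_nonneg [simp]: "0 \<le> H1norm f"
  by (simp add: H1norm_def)

lemma L2norm_le_H1norm: "L2norm f \<le> H1norm f" "L2norm (Dx f) \<le> H1norm f"
  by (simp_all add: H1norm_def)

lemma smooth_H1D:
  assumes "f \<in> smooth_H1"
  shows "smooth f" "square_integrable f" "square_integrable (Dx f)" "smooth (Dx f)"
    "f \<in> borel_measurable borel" "Dx f \<in> borel_measurable borel"
  using assms by (auto simp: smooth_H1_def intro: smooth_Dx smooth_borel)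

lemma smooth_H1_integral_by_parts:
  assumes "f \<in> smooth_H1" "g \<in> smooth_H1"
  shows "(LINT x|lborel. f x * Dx g x) = - (LINT x|lborel. Dx f x * g x)"
  using assms by (intro integral_by_parts smooth_H1D)

lemma smooth_H1_add: "f \<in> smooth_H1 \<Longrightarrow> g \<in> smooth_H1 \<Longrightarrow> (\<lambda>x. f x + g x) \<in> smooth_H1"
  and smooth_H1_diff: "f \<in> smooth_H1 \<Longrightarrow> g \<in> smooth_H1 \<Longrightarrow> (\<lambda>x. f x - g x) \<in> smooth_H1"
  and smooth_H1_cmult: "f \<in> smooth_H1 \<Longrightarrow> (\<lambda>x. c * f x) \<in> smooth_H1"
  and smooth_H1_cnj: "f \<in> smooth_H1 \<Longrightarrow> (\<lambda>x. cnj (f x)) \<in> smooth_H1"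
  and smooth_H1_shift: "f \<in> smooth_H1 \<Longrightarrow> (\<lambda>x. f (d + x)) \<in> smooth_H1"
  using smooth_affine[of f d 1] Dx_affine[of f d 1]
  by (simp_all add: smooth_H1_def smooth_add smooth_diff smooth_mult smooth_const smooth_cnj
      Dx_add Dx_diff Dx_cmult Dx_cnj square_integrable_add square_integrable_diff
      square_integrable_cmult square_integrable_cnj square_integrable_shift)

lemma H1norm_triangle: "f \<in> smooth_H1 \<Longrightarrow> g \<in> smooth_H1 \<Longrightarrow> H1norm (\<lambda>x. f x + g x) \<le> H1norm f + H1norm g"
  using L2norm_triangle[of f g] L2norm_triangle[of "Dx f" "Dx g"]
  by (simp add: smooth_H1_def H1norm_def Dx_add)

lemma H1norm_diff_triangle:
  "f \<in> smooth_H1 \<Longrightarrow> g \<in> smooth_H1 \<Longrightarrow> \<bar>H1norm f - H1norm g\<bar> \<le> H1norm (\<lambda>x. f x - g x)"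
  using L2norm_diff_triangle[of f g] L2norm_diff_triangle[of "Dx f" "Dx g"]
  by (simp add: smooth_H1_def H1norm_def Dx_diff)

lemma H1norm_cmult: "smooth f \<Longrightarrow> H1norm (\<lambda>x. c * f x) = cmod c * H1norm f"
  and H1norm_cnj: "smooth f \<Longrightarrow> H1norm (\<lambda>x. cnj (f x)) = H1norm f"
  and H1norm_shift: "smooth f \<Longrightarrow> H1norm (\<lambda>x. f (d + x)) = H1norm f"
  using Dx_affine[of f d 1]
  by (simp_all add: H1norm_def Dx_cmult Dx_cnj L2norm_cmult L2norm_cnj L2norm_shift distrib_left)

text \<open>Sobolev embedding. The derivative of |f|^2 has L^1 norm at most K, so |f(x)|^2 \<le>
  |f(y)|^2 + K for y \<ge> x. Averaging over y in an interval of length 1 gives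
  \<open>L2norm f\<close> squared plus K, which is at most the square of the sum of the two norms;
  hence the constant 1.\<close>

lemma cmod_le_H1norm:
  assumes f: "f \<in> smooth_H1"
  shows "cmod (f x) \<le> H1norm f"
proof -
  note f' = smooth_H1D[OF f]
  define g where "g = (\<lambda>x. f x * cnj (f x))"
  define K where "K = 2 * (L2norm f * L2norm (Dx f))"
  have g: "smooth g" unfolding g_def by (intro smooth_mult smooth_cnj f')
  have Dg: "Dx g = (\<lambda>x. f x * cnj (Dx f x) + Dx f x * cnj (f x))"
    unfolding g_def using f' by (simp add: Dx_mult smooth_cnj Dx_cnj)
  have cg: "cmod (g y) = (cmod (f y))\<^sup>2" for y
    by (simp add: g_def norm_mult power2_eq_square)
  note int = integrable_mult_cmod[OF f'(2,3)]
  have Dg_int: "integrable lborel (Dx g)"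
    unfolding Dg by (intro Bochner_Integration.integrable_add integrable_mult_L2 square_integrable_cnj f')
  have le: "(cmod (f x))\<^sup>2 \<le> (cmod (f y))\<^sup>2 + K" if "x \<le> y" for y
  proof -
    have "(LINT z|lborel. indicator {x..y} z *\<^sub>R Dx g z) = g y - g x"
    proof (rule integral_FTC_atLeastAtMost[OF that])
      show "(g has_vector_derivative Dx g z) (at z within {x..y})" for z
        using smooth_has_derivative[OF g] has_vector_derivative_at_within by blast
      show "continuous_on {x..y} (Dx g)" by (intro smooth_continuous smooth_Dx g)
    qed
    then have "cmod (g y - g x) = cmod (LINT z|lborel. indicator {x..y} z *\<^sub>R Dx g z)" by simp
    also have "\<dots> \<le> (LINT z|lborel. cmod (indicator {x..y} z *\<^sub>R Dx g z))"
      by (rule integral_norm_bound)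
    also have "\<dots> \<le> (LINT z|lborel. 2 * (cmod (f z) * cmod (Dx f z)))"
    proof (rule integral_mono)
      show "integrable lborel (\<lambda>z. cmod (indicator {x..y} z *\<^sub>R Dx g z))"
        by (intro integrable_norm integrable_mult_indicator Dg_int) auto
      have "cmod (Dx g z) \<le> 2 * (cmod (f z) * cmod (Dx f z))" for z
        unfolding Dg using norm_triangle_ineq[of "f z * cnj (Dx f z)" "Dx f z * cnj (f z)"]
        by (simp add: norm_mult mult_ac)
      then show "cmod (indicator {x..y} z *\<^sub>R Dx g z) \<le> 2 * (cmod (f z) * cmod (Dx f z))" for z
        by (simp add: indicator_def)
    qed (use int in auto)
    also have "\<dots> \<le> K"
      using Cauchy_Schwarz_cmod[OF f'(2,3)] int by (simp add: K_def)
    finally have "cmod (g x) \<le> cmod (g y) + K"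
      by (smt (verit) norm_triangle_ineq2 norm_minus_commute)
    then show ?thesis by (simp add: cg)
  qed
  have "(LINT y|lborel. indicator {x..x+1} y * (cmod (f x))\<^sup>2) \<le>
      (LINT y|lborel. (cmod (f y))\<^sup>2 + indicator {x..x+1} y * K)"
  proof (rule integral_mono)
    show "integrable lborel (\<lambda>y. (cmod (f y))\<^sup>2 + indicator {x..x+1} y * K)"
      using f'(2) by (intro Bochner_Integration.integrable_add integrable_mult_left)
        (auto simp: square_integrable_def integrable_indicator_iff emeasure_lborel_Icc_eq)
    show "indicator {x..x+1} y * (cmod (f x))\<^sup>2 \<le> (cmod (f y))\<^sup>2 + indicator {x..x+1} y * K" for y
      using le[of y] by (auto simp: indicator_def)
  qed (auto intro!: integrable_mult_left simp: integrable_indicator_iff emeasure_lborel_Icc_eq)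
  also have "\<dots> = (L2norm f)\<^sup>2 + K"
    using f'(2) by (subst Bochner_Integration.integral_add)
      (auto simp: L2norm_power2 square_integrable_def integrable_indicator_iff emeasure_lborel_Icc_eq
        intro!: integrable_mult_left)
  also have "\<dots> \<le> (H1norm f)\<^sup>2"
    by (simp add: K_def H1norm_def power2_sum)
  finally have "(cmod (f x))\<^sup>2 \<le> (H1norm f)\<^sup>2" by simp
  then show ?thesis by (rule power2_le_imp_le) simp
qed

text \<open>One factor is put in the sup norm by the Sobolev embedding. The 3 counts the L^2 norms
  to be bounded: that of f g and those of the two terms of its derivative.\<close>

lemma smooth_H1_mult:
  assumes "f \<in> smooth_H1" "g \<in> smooth_H1"
  shows "(\<lambda>x. f x * g x) \<in> smooth_H1" and "H1norm (\<lambda>x. f x * g x) \<le> 3 * (H1norm f * H1norm g)"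
proof -
  note f = smooth_H1D[OF assms(1)] and g = smooth_H1D[OF assms(2)]
  note bf = square_integrable_bounded_mult[OF _ f(5) cmod_le_H1norm[OF assms(1)]]
  note bg = square_integrable_bounded_mult[OF _ g(5) cmod_le_H1norm[OF assms(2)]]
  have D: "Dx (\<lambda>x. f x * g x) = (\<lambda>x. f x * Dx g x + g x * Dx f x)"
    using f g by (simp add: Dx_mult mult.commute)
  show "(\<lambda>x. f x * g x) \<in> smooth_H1"
    unfolding smooth_H1_def mem_Collect_eq D
    by (intro conjI square_integrable_add bf bg f g smooth_mult)
  have "L2norm (\<lambda>x. f x * g x) \<le> H1norm f * H1norm g"
    using bf(2)[OF g(2)] L2norm_le_H1norm(1)[of g] by (meson H1norm_nonneg mult_left_mono order_trans)
  moreover have "L2norm (\<lambda>x. f x * Dx g x) \<le> H1norm f * H1norm g"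
    using bf(2)[OF g(3)] L2norm_le_H1norm(2)[of g] by (meson H1norm_nonneg mult_left_mono order_trans)
  moreover have "L2norm (\<lambda>x. g x * Dx f x) \<le> H1norm f * H1norm g"
    using bg(2)[OF f(3)] L2norm_le_H1norm(2)[of f]
    by (metis H1norm_nonneg mult.commute mult_left_mono order_trans)
  ultimately show "H1norm (\<lambda>x. f x * g x) \<le> 3 * (H1norm f * H1norm g)"
    unfolding H1norm_def[of "\<lambda>x. f x * g x"] D
    using L2norm_triangle[OF bf(1)[OF g(3)] bg(1)[OF f(3)]] by linarith
qed

section \<open>Difference quotients\<close>


lemma compact_support_smooth_H1:
  assumes "smooth f" "\<And>x. \<bar>x\<bar> \<ge> R \<Longrightarrow> f x = 0"
  shows "f \<in> smooth_H1"
proof -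
  have *: "square_integrable g" if "smooth g" "\<And>x. \<bar>x\<bar> > R \<Longrightarrow> g x = 0" for g
  proof -
    have "integrable lborel (\<lambda>x. complex_of_real ((cmod (g x))\<^sup>2))"
      by (rule compact_support_integrable[of _ R])
        (use that in \<open>simp, intro continuous_intros smooth_continuous, simp_all\<close>)
    then have "integrable lborel (\<lambda>x. Re (complex_of_real ((cmod (g x))\<^sup>2)))"
      by (rule integrable_Re)
    then show ?thesis using that by (simp add: square_integrable_def smooth_borel)
  qed
  show ?thesis
    unfolding smooth_H1_def mem_Collect_eq
  proof (intro conjI *)
    show "Dx f x = 0" if "\<bar>x\<bar> > R" for x using Dx_eq_0_outside assms(2) that by blast
  qed (use assms smooth_Dx in auto)
qed

lemma cutoff_smooth_H1: "cutoff n \<in> smooth_H1"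
  by (rule compact_support_smooth_H1[OF smooth_cutoff cutoff_eq_0])

lemma test_function_cutoff_mult:
  assumes "smooth f"
  shows "test_function (\<lambda>x. cutoff n x * f x)"
proof -
  have "{x. cutoff n x * f x \<noteq> 0} \<subseteq> cball 0 (real (Suc n))"
  proof
    fix x assume "x \<in> {x. cutoff n x * f x \<noteq> 0}"
    then have "\<not> real (Suc n) \<le> \<bar>x\<bar>" using cutoff_eq_0[of n x] by auto
    then show "x \<in> cball 0 (real (Suc n))" by simp
  qed
  then show ?thesis
    unfolding test_function_def
    by (intro conjI smooth_mult smooth_cutoff assms bounded_subset[OF bounded_cball])
qed

lemma test_function_smooth_H1:
  assumes "test_function \<phi>"
  shows "\<phi> \<in> smooth_H1"
proof -
  obtain R where "\<forall>x\<in>{x. \<phi> x \<noteq> 0}. norm x \<le> R"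
    using assms unfolding test_function_def bounded_iff by blast
  then have "\<phi> x = 0" if "\<bar>x\<bar> \<ge> R + 1" for x
    using that by (cases "\<phi> x = 0") auto
  with assms show ?thesis
    by (auto simp: test_function_def intro: compact_support_smooth_H1)
qed

text \<open>This density statement carries the equation from test functions to all of
  \<open>smooth_H1\<close>. By the product rule the only new term is f times the derivative of the
  cutoff, which dominated convergence removes.\<close>

lemma cutoff_mult_tendsto_H1:
  assumes f: "f \<in> smooth_H1"
  shows "(\<lambda>n. H1norm (\<lambda>x. cutoff n x * f x - f x)) \<longlonglongrightarrow> 0"
proof -
  note f' = smooth_H1D[OF f]
  obtain B where B: "B \<ge> 1" "\<And>n x. cmod (cutoff n x) \<le> B" "\<And>n x. cmod (Dx (cutoff n) x) \<le> B"
    "\<And>n x. cmod (x * Dx (cutoff n) x) \<le> B"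
    using cutoff_bounds by blast
  have [measurable]: "f \<in> borel_measurable borel" "Dx f \<in> borel_measurable borel"
    "cutoff n \<in> borel_measurable borel" "Dx (cutoff n) \<in> borel_measurable borel" for n
    by (auto intro: f' smooth_borel smooth_Dx smooth_cutoff)
  have 1: "(\<lambda>n. L2norm (\<lambda>x. cutoff n x * g x - g x)) \<longlonglongrightarrow> 0"
    if g: "square_integrable g" for g
  proof (rule L2norm_dominated_convergence)
    note [measurable] = square_integrable_borel[OF g]
    show "square_integrable (\<lambda>x. of_real (B + 1) * g x)" by (rule square_integrable_cmult[OF g])
    show "(\<lambda>x. cutoff n x * g x - g x) \<in> borel_measurable borel" for n by measurable
    show "cmod (cutoff n x * g x - g x) \<le> cmod (of_real (B + 1) * g x)" for n x
    proof -
      have eq: "cutoff n x * g x - g x = (cutoff n x - 1) * g x" by (simp add: left_diff_distrib)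
      have "cmod (cutoff n x - 1) \<le> B + 1"
        using norm_triangle_ineq4[of "cutoff n x" 1] B(2)[of n x] by simp
      then show ?thesis
        using mult_right_mono[OF _ norm_ge_zero[of "g x"]] B(1)
        by (simp add: norm_mult eq)
    qed
    have "(\<lambda>n. cutoff n x * g x - g x) \<longlonglongrightarrow> 1 * g x - g x" for x
      by (intro tendsto_intros cutoff_tendsto)
    then show "(\<lambda>n. cutoff n x * g x - g x) \<longlonglongrightarrow> 0" for x by simp
  qed
  have 2: "(\<lambda>n. L2norm (\<lambda>x. Dx (cutoff n) x * f x)) \<longlonglongrightarrow> 0"
  proof (rule L2norm_dominated_convergence)
    show "square_integrable (\<lambda>x. of_real B * f x)" by (rule square_integrable_cmult[OF f'(2)])
    show "cmod (Dx (cutoff n) x * f x) \<le> cmod (of_real B * f x)" for n x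
      using B(1) B(3)[of n x] by (simp add: norm_mult mult_right_mono)
    have "(\<lambda>n. Dx (cutoff n) x * f x) \<longlonglongrightarrow> 0 * f x" for x
      by (intro tendsto_intros Dx_cutoff_tendsto)
    then show "(\<lambda>n. Dx (cutoff n) x * f x) \<longlonglongrightarrow> 0" for x by simp
  qed measurable
  have D: "Dx (\<lambda>x. cutoff n x * f x - f x) = (\<lambda>x. (cutoff n x * Dx f x - Dx f x) + Dx (cutoff n) x * f x)" for n
    using f' by (simp add: Dx_diff Dx_mult smooth_cutoff smooth_mult fun_eq_iff)
  show ?thesis
  proof (rule tendsto_sandwich[OF _ _ tendsto_const])
    show "(\<lambda>n. L2norm (\<lambda>x. cutoff n x * f x - f x) + (L2norm (\<lambda>x. cutoff n x * Dx f x - Dx f x)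
      + L2norm (\<lambda>x. Dx (cutoff n) x * f x))) \<longlonglongrightarrow> 0"
      using tendsto_add[OF 1[OF f'(2)] tendsto_add[OF 1[OF f'(3)] 2]] by simp
    have "square_integrable (\<lambda>x. cutoff n x * g x)" if "square_integrable g" for n g
      by (rule square_integrable_bounded_mult[OF that _ B(2)]) measurable
    moreover have "square_integrable (\<lambda>x. Dx (cutoff n) x * f x)" for n
      by (rule square_integrable_bounded_mult[OF f'(2) _ B(3)]) measurable
    ultimately show "\<forall>\<^sub>F n in sequentially. H1norm (\<lambda>x. cutoff n x * f x - f x) \<le>
      L2norm (\<lambda>x. cutoff n x * f x - f x) + (L2norm (\<lambda>x. cutoff n x * Dx f x - Dx f x)
      + L2norm (\<lambda>x. Dx (cutoff n) x * f x))"
      unfolding H1norm_def D using f'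
      by (intro always_eventually allI add_left_mono L2norm_triangle square_integrable_diff) auto
  qed simp
qed

lemma square_integrable_indicator_Icc: "square_integrable (indicator {a..b})"
proof -
  have "(\<lambda>x. (cmod (indicator {a..b} x))\<^sup>2) = indicator {a..b}"
    by (auto simp: indicator_def fun_eq_iff)
  then show ?thesis
    by (simp add: square_integrable_def integrable_indicator_iff emeasure_lborel_Icc_eq)
qed

text \<open>Cauchy-Schwarz on [x, x + d] bounds the squared increment by d times the integral of
  |f'|^2 over that interval. Integrating in x and exchanging the integrals gives a second factor d,
  since a given y lies in [x, x + d] exactly for x in an interval of length d.\<close>

lemma L2norm_shift_diff_le:
  assumes f: "f \<in> smooth_H1" and d: "d \<ge> 0"
  shows "L2norm (\<lambda>x. f (d + x) - f x) \<le> d * L2norm (Dx f)"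
proof -
  note f' = smooth_H1D[OF f]
  note [measurable] = f'(5,6)
  have sq: "square_integrable (\<lambda>x. f (d + x) - f x)"
    by (intro square_integrable_diff square_integrable_shift f')
  have int: "integrable lborel (\<lambda>x. (cmod (Dx f x))\<^sup>2)"
    using f'(3) by (simp add: square_integrable_def)
  have pt: "(cmod (f (d + x) - f x))\<^sup>2 \<le> d * (LINT y|lborel. indicator {x..d+x} y * (cmod (Dx f y))\<^sup>2)" for x
  proof -
    have I: "square_integrable (\<lambda>y. indicator {x..d+x} y)"
      by (rule square_integrable_indicator_Icc)
    have J: "square_integrable (\<lambda>y. indicator {x..d+x} y * Dx f y)"
      by (rule square_integrable_bounded_mult[OF f'(3), of _ 1]) (auto simp: indicator_def)
    have "(LINT y|lborel. indicator {x..d+x} y *\<^sub>R Dx f y) = f (d+x) - f x"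
    proof (rule integral_FTC_atLeastAtMost)
      show "(f has_vector_derivative Dx f z) (at z within {x..d+x})" for z
        using smooth_has_derivative[OF f'(1)] has_vector_derivative_at_within by blast
      show "continuous_on {x..d+x} (Dx f)" by (intro smooth_continuous f')
    qed (use d in simp)
    moreover have "(\<lambda>y. indicator {x..d+x} y *\<^sub>R Dx f y) =
        (\<lambda>y. indicator {x..d+x} y * (indicator {x..d+x} y * Dx f y))"
      by (auto simp: indicator_def)
    ultimately have "cmod (f (d+x) - f x) \<le> L2norm (indicator {x..d+x}) * L2norm (\<lambda>y. indicator {x..d+x} y * Dx f y)"
      using Cauchy_Schwarz_L2[OF I J] by simp
    then have "(cmod (f (d+x) - f x))\<^sup>2 \<le> (L2norm (indicator {x..d+x}))\<^sup>2 * (L2norm (\<lambda>y. indicator {x..d+x} y * Dx f y))\<^sup>2"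
      using power_mono[of _ _ 2] by (fastforce simp: power_mult_distrib)
    also have "(L2norm (indicator {x..d+x}))\<^sup>2 = (LINT y|lborel. indicator {x..d+x} y)"
      unfolding L2norm_power2 by (rule Bochner_Integration.integral_cong) (auto simp: indicator_def)
    also have "\<dots> = d"
      using d by simp
    also have "(L2norm (\<lambda>y. indicator {x..d+x} y * Dx f y))\<^sup>2 = (LINT y|lborel. indicator {x..d+x} y * (cmod (Dx f y))\<^sup>2)"
      unfolding L2norm_power2 by (rule Bochner_Integration.integral_cong) (auto simp: indicator_def)
    finally show ?thesis .
  qed
  have int_x: "integrable lborel (\<lambda>y. indicator {x..d+x} y * (cmod (Dx f y))\<^sup>2)" for x
    using integrable_mult_indicator[OF _ int, of "{x..d+x}"] by simp
  have "ennreal ((L2norm (\<lambda>x. f (d + x) - f x))\<^sup>2) = (\<integral>\<^sup>+x. ennreal ((cmod (f (d + x) - f x))\<^sup>2) \<partial>lborel)"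
    unfolding L2norm_power2 using sq by (intro nn_integral_eq_integral[symmetric]) (auto simp: square_integrable_def)
  also have "\<dots> \<le> (\<integral>\<^sup>+x. (\<integral>\<^sup>+y. ennreal (d * (indicator {x..d+x} y * (cmod (Dx f y))\<^sup>2)) \<partial>lborel) \<partial>lborel)"
  proof (rule nn_integral_mono)
    fix x :: real
    have "(\<integral>\<^sup>+y. ennreal (d * (indicator {x..d+x} y * (cmod (Dx f y))\<^sup>2)) \<partial>lborel) =
       ennreal (LINT y|lborel. d * (indicator {x..d+x} y * (cmod (Dx f y))\<^sup>2))"
      using int_x d by (intro nn_integral_eq_integral) auto
    then show "ennreal ((cmod (f (d + x) - f x))\<^sup>2) \<le>
        (\<integral>\<^sup>+y. ennreal (d * (indicator {x..d+x} y * (cmod (Dx f y))\<^sup>2)) \<partial>lborel)"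
      using pt[of x] by (simp add: ennreal_leI)
  qed
  also have "\<dots> = (\<integral>\<^sup>+y. (\<integral>\<^sup>+x. ennreal (d * (indicator {x..d+x} y * (cmod (Dx f y))\<^sup>2)) \<partial>lborel) \<partial>lborel)"
    by (rule lborel_pair.Fubini'[symmetric]) (simp add: indicator_def, measurable)
  also have "\<dots> = (\<integral>\<^sup>+y. ennreal (d\<^sup>2 * (cmod (Dx f y))\<^sup>2) \<partial>lborel)"
  proof (rule nn_integral_cong)
    fix y :: real
    have "(\<integral>\<^sup>+x. ennreal (d * (indicator {x..d+x} y * (cmod (Dx f y))\<^sup>2)) \<partial>lborel) =
      (\<integral>\<^sup>+x. ennreal (d * (cmod (Dx f y))\<^sup>2) * indicator {y-d..y} x \<partial>lborel)"
      by (rule nn_integral_cong) (auto simp: indicator_def)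
    also have "\<dots> = ennreal (d * (cmod (Dx f y))\<^sup>2) * emeasure lborel {y-d..y}"
      by (rule nn_integral_cmult_indicator) simp
    also have "\<dots> = ennreal (d\<^sup>2 * (cmod (Dx f y))\<^sup>2)"
      using d by (simp add: power2_eq_square mult_ac flip: ennreal_mult)
    finally show "(\<integral>\<^sup>+x. ennreal (d * (indicator {x..d+x} y * (cmod (Dx f y))\<^sup>2)) \<partial>lborel) = \<dots>" .
  qed
  also have "\<dots> = ennreal (LINT y|lborel. d\<^sup>2 * (cmod (Dx f y))\<^sup>2)"
    using int by (intro nn_integral_eq_integral) auto
  also have "(LINT y|lborel. d\<^sup>2 * (cmod (Dx f y))\<^sup>2) = (d * L2norm (Dx f))\<^sup>2"
    by (simp add: power_mult_distrib L2norm_power2)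
  finally have "(L2norm (\<lambda>x. f (d + x) - f x))\<^sup>2 \<le> (d * L2norm (Dx f))\<^sup>2"
    by simp
  then show ?thesis by (rule power2_le_imp_le) (simp add: d)
qed

section \<open>The centred difference quotient\<close>

text \<open>Centring makes it skew for the bilinear pairing (\<open>integral_diffq\<close>), as
  \<partial>_x is; a one-sided quotient would be turned into the one of opposite step. At d = 0 it
  is the zero operator, so the algebraic identities hold for every real d.\<close>

definition diffq :: "real \<Rightarrow> (real \<Rightarrow> complex) \<Rightarrow> real \<Rightarrow> complex" where
  "diffq d f x = complex_of_real (inverse (2 * d)) * (f (d + x) - f (- d + x))"

lemma smooth_H1_diffq: "f \<in> smooth_H1 \<Longrightarrow> diffq d f \<in> smooth_H1"
  unfolding diffq_def[abs_def] by (intro smooth_H1_cmult smooth_H1_diff smooth_H1_shift)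

lemma square_integrable_diffq: "square_integrable f \<Longrightarrow> square_integrable (diffq d f)"
  unfolding diffq_def[abs_def]
  by (intro square_integrable_cmult square_integrable_diff square_integrable_shift)

lemma diffq_cnj: "diffq d (\<lambda>x. cnj (f x)) x = cnj (diffq d f x)"
  by (simp add: diffq_def)

lemma Dx_diffq:
  assumes "smooth f"
  shows "Dx (diffq d f) = diffq d (Dx f)"
proof -
  have s: "smooth (\<lambda>x. f (a + x))" for a using smooth_affine[OF assms, of a 1] by simp
  have D: "Dx (\<lambda>x. f (a + x)) = (\<lambda>x. Dx f (a + x))" for a
    using Dx_affine[OF assms, of a 1] by simp
  show ?thesis
    unfolding diffq_def[abs_def] Dx_cmult[OF smooth_diff[OF s s]] Dx_diff[OF s s] D ..
qed

lemma integral_diffq: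
  assumes "square_integrable f" "square_integrable g"
  shows "(LINT x|lborel. diffq d f x * g x) = - (LINT x|lborel. f x * diffq d g x)"
proof -
  have int: "integrable lborel (\<lambda>x. f (a + x) * g (b + x))" for a b
    by (intro integrable_mult_L2 square_integrable_shift assms)
  have eq: "(LINT x|lborel. f (a + x) * g x) = (LINT x|lborel. f x * g (- a + x))" for a
    using integral_shift[of "\<lambda>x. f x * g (- a + x)" a] by (simp add: add.assoc[symmetric])
  obtain c where c: "diffq d h = (\<lambda>x. c * (h (d + x) - h (- d + x)))" for h
    by (simp only: diffq_def[abs_def])
  have "(LINT x|lborel. diffq d f x * g x) = c *
     ((LINT x|lborel. f (d + x) * g x) - (LINT x|lborel. f (- d + x) * g x))"
    using int[of d 0] int[of "- d" 0] by (simp add: c left_diff_distrib mult.assoc)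
  also have "\<dots> = - (LINT x|lborel. f x * diffq d g x)"
    unfolding eq using int[of 0 d] int[of 0 "- d"]
    by (simp add: c right_diff_distrib mult.left_commute[of _ c])
  finally show ?thesis .
qed

lemma L2norm_diffq_le:
  assumes f: "f \<in> smooth_H1" and d: "d > 0"
  shows "L2norm (diffq d f) \<le> L2norm (Dx f)"
proof -
  \<comment> \<open>Translating by d turns the centred difference into a one-sided one of step 2
    d.\<close>
  have "L2norm (\<lambda>x. f (d + x) - f (- d + x)) = L2norm (\<lambda>x. f (2 * d + (- d + x)) - f (- d + x))"
    by (simp add: algebra_simps)
  also have "\<dots> = L2norm (\<lambda>x. f (2 * d + x) - f x)"
    by (rule L2norm_shift)
  also have "\<dots> \<le> 2 * d * L2norm (Dx f)"
    using L2norm_shift_diff_le[OF f, of "2 * d"] d by simp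
  finally show ?thesis
    unfolding diffq_def[abs_def] L2norm_cmult using d by (simp add: field_simps norm_inverse norm_mult norm_divide)
qed

lemma norm_diff_le_vector_derivative:
  fixes f :: "real \<Rightarrow> 'a::real_normed_vector"
  assumes "convex S" "a \<in> S" "b \<in> S" "\<And>x. x \<in> S \<Longrightarrow> (f has_vector_derivative f' x) (at x)"
    "\<And>x. x \<in> S \<Longrightarrow> norm (f' x) \<le> B"
  shows "norm (f b - f a) \<le> B * \<bar>b - a\<bar>"
proof -
  have "norm (f b - f a) \<le> B * norm (b - a)"
  proof (rule differentiable_bound[OF assms(1) _ _ assms(3,2)])
    fix x assume x: "x \<in> S"
    show "(f has_derivative (\<lambda>h. h *\<^sub>R f' x)) (at x within S)"
      using has_vector_derivative_at_within[OF assms(4)[OF x]] by (simp add: has_vector_derivative_def)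
    show "onorm (\<lambda>h. h *\<^sub>R f' x) \<le> B"
      using assms(5)[OF x] by (intro onorm_le) (simp add: mult.commute[of B] mult_left_mono)
  qed
  then show ?thesis by simp
qed

lemma diffq_tendsto_Dx:
  assumes "smooth f"
  shows "(\<lambda>n. diffq (inverse (real (Suc n))) f x) \<longlonglongrightarrow> Dx f x"
proof -
  \<comment> \<open>The relative remainder in the definition of the derivative. The centred quotient
    errs by at most the mean of the remainders at d and -d.\<close>
  define N where "N h = norm (f (x + h) - f x - h *\<^sub>R Dx f x) / norm h" for h
  define d where "d n = inverse (real (Suc n))" for n
  have d: "d n > 0" for n by (simp add: d_def)
  have N: "(N \<longlongrightarrow> 0) (at 0)"
    using smooth_has_derivative[OF assms, of x]
    unfolding has_vector_derivative_def has_derivative_at N_def[abs_def] by blast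
  have "d \<longlonglongrightarrow> 0" unfolding d_def by (rule LIMSEQ_inverse_real_of_nat)
  then have "filterlim d (at 0) sequentially" "filterlim (\<lambda>n. - d n) (at 0) sequentially"
    using d tendsto_minus[of d 0 sequentially] by (auto simp: filterlim_at less_imp_neq[THEN not_sym])
  then have "(\<lambda>n. (N (d n) + N (- d n)) / 2) \<longlonglongrightarrow> (0 + 0) / 2"
    by (intro tendsto_intros filterlim_compose[OF N]) auto
  then have lim: "(\<lambda>n. (N (d n) + N (- d n)) / 2) \<longlonglongrightarrow> 0" by simp
  have "(\<lambda>n. diffq (d n) f x - Dx f x) \<longlonglongrightarrow> 0"
  proof (rule Lim_null_comparison[OF _ lim], intro always_eventually allI)
    fix n
    have nd: "norm (complex_of_real (2 * d n)) = 2 * d n" using d[of n] by simp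
    have "diffq (d n) f x - Dx f x = ((f (x + d n) - f x - d n *\<^sub>R Dx f x) -
      (f (x + - d n) - f x - (- d n) *\<^sub>R Dx f x)) / of_real (2 * d n)"
      using d[of n] by (simp add: diffq_def scaleR_conv_of_real field_simps)
    also have "norm \<dots> \<le> (norm (f (x + d n) - f x - d n *\<^sub>R Dx f x) +
      norm (f (x + - d n) - f x - (- d n) *\<^sub>R Dx f x)) / (2 * d n)"
      unfolding norm_divide nd using d[of n] by (intro divide_right_mono norm_triangle_ineq4) simp
    also have "\<dots> = (N (d n) + N (- d n)) / 2"
      using d[of n] by (simp add: N_def add_divide_distrib mult.commute)
    finally show "norm (diffq (d n) f x - Dx f x) \<le> (N (d n) + N (- d n)) / 2" .
  qed
  then show ?thesis by (simp add: d_def LIM_zero_iff)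
qed

text \<open>The errors are bounded in L^2 and tend to 0 pointwise, boundedly on compact intervals.
  Splitting g at \<plusminus>k, dominated convergence handles the inner part, and Cauchy-Schwarz
  bounds the outer part by the tail of g uniformly in n.\<close>

lemma diffq_tendsto_Dx_weakly:
  assumes f: "f \<in> smooth_H1" and g: "square_integrable g"
  shows "(\<lambda>n. LINT x|lborel. diffq (inverse (real (Suc n))) f x * g x) \<longlonglongrightarrow> (LINT x|lborel. Dx f x * g x)"
proof -
  note f' = smooth_H1D[OF f]
  note [measurable] = f'(5,6) square_integrable_borel[OF g]
  define e where "e n x = diffq (inverse (real (Suc n))) f x - Dx f x" for n x
  define M where "M = 2 * L2norm (Dx f) + 1"
  have "M > 0" by (simp add: M_def add_nonneg_pos)
  have e: "square_integrable (e n)" for n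
    unfolding e_def[abs_def] by (intro square_integrable_diff square_integrable_diffq f')
  have e_le: "L2norm (e n) \<le> M" for n
  proof -
    have "L2norm (\<lambda>x. diffq (inverse (real (Suc n))) f x + - 1 * Dx f x)
      \<le> L2norm (diffq (inverse (real (Suc n))) f) + L2norm (\<lambda>x. - 1 * Dx f x)"
      by (intro L2norm_triangle square_integrable_diffq square_integrable_cmult f')
    then show ?thesis
      using L2norm_diffq_le[OF f, of "inverse (real (Suc n))"]
      by (simp add: e_def[abs_def] M_def L2norm_minus)
  qed
  have near: "(\<lambda>n. LINT x|lborel. e n x * (indicator {-real k..real k} x * g x)) \<longlonglongrightarrow> 0" for k
  proof -
    \<comment> \<open>One unit wider on each side, because the steps d are at most 1 and the
      quotient at x sees [x - d, x + d].\<close>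
    have "bounded (Dx f ` {-real k - 1..real k + 1})"
      by (intro compact_imp_bounded compact_continuous_image smooth_continuous f' compact_Icc)
    then obtain S where S: "\<And>x. x \<in> {-real k - 1..real k + 1} \<Longrightarrow> cmod (Dx f x) \<le> S"
      unfolding bounded_iff by blast
    have e_bound: "cmod (e n x) \<le> 2 * S" if x: "x \<in> {-real k..real k}" for n x
    proof -
      define d where "d = inverse (real (Suc n))"
      have d: "0 < d" "d \<le> 1" by (auto simp: d_def inverse_le_1_iff)
      have "cmod (f (d + x) - f (- d + x)) \<le> S * \<bar>(d + x) - (- d + x)\<bar>"
        by (rule norm_diff_le_vector_derivative[where S="{-real k - 1..real k + 1}"])
          (use d x S smooth_has_derivative[OF f'(1)] in auto)
      then have "cmod (diffq d f x) \<le> S"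
        using d by (simp add: diffq_def norm_mult norm_inverse norm_divide field_simps)
      moreover have "cmod (Dx f x) \<le> S" using S[of x] x by auto
      ultimately show ?thesis
        using norm_triangle_ineq4[of "diffq d f x" "Dx f x"] by (simp add: e_def d_def)
    qed
    have "(\<lambda>n. LINT x|lborel. e n x * (indicator {-real k..real k} x * g x)) \<longlonglongrightarrow> (LINT x::real|lborel. 0::complex)"
    proof (rule integral_dominated_convergence)
      show "integrable lborel (\<lambda>x. 2 * S * (cmod (indicator {-real k..real k} x) * cmod (g x)))"
        by (intro integrable_mult_right integrable_mult_cmod g square_integrable_indicator_Icc)
      have "(\<lambda>n. e n x * (indicator {-real k..real k} x * g x)) \<longlonglongrightarrow>
         (Dx f x - Dx f x) * (indicator {-real k..real k} x * g x)" for x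
        unfolding e_def by (intro tendsto_intros diffq_tendsto_Dx f')
      then show "AE x in lborel. (\<lambda>n. e n x * (indicator {-real k..real k} x * g x)) \<longlonglongrightarrow> 0" by simp
      have "norm (e n x * (indicator {-real k..real k} x * g x))
        \<le> 2 * S * (cmod (indicator {-real k..real k} x) * cmod (g x))" for n x
        using e_bound[of x n] by (simp add: norm_mult indicator_def mult_right_mono)
      then show "AE x in lborel. norm (e n x * (indicator {-real k..real k} x * g x))
        \<le> 2 * S * (cmod (indicator {-real k..real k} x) * cmod (g x))" for n by simp
    qed (use e in \<open>auto intro!: borel_measurable_times simp: square_integrable_def\<close>)
    then show ?thesis by simp
  qed
  have far: "(\<lambda>k. L2norm (\<lambda>x. indicator (-{-real k..real k}) x * g x)) \<longlonglongrightarrow> 0"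
  proof (rule L2norm_dominated_convergence[OF g])
    show "cmod (indicator (- {- real k..real k}) x * g x) \<le> cmod (g x)" for k x
      by (simp add: indicator_def)
    fix x
    obtain k0 where "\<bar>x\<bar> \<le> real k0" using real_arch_simple by blast
    then have "indicator (-{-real k..real k}) x * g x = 0" if "k \<ge> k0" for k
      using that by (auto simp: indicator_def)
    then show "(\<lambda>k. indicator (-{-real k..real k}) x * g x) \<longlonglongrightarrow> 0"
      by (intro tendsto_eventually) (auto simp: eventually_sequentially)
  qed measurable
  have split: "cmod (LINT x|lborel. e n x * g x) \<le>
     cmod (LINT x|lborel. e n x * (indicator {-real k..real k} x * g x)) +
     M * L2norm (\<lambda>x. indicator (-{-real k..real k}) x * g x)" for n k
  proof -
    have sq: "square_integrable (\<lambda>x. indicator A x * g x)" if "A \<in> sets borel" for A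
      by (rule square_integrable_bounded_mult[OF g, of _ 1]) (use that in \<open>auto simp: indicator_def\<close>)
    have s1: "square_integrable (\<lambda>x. indicator {-real k..real k} x * g x)"
      and s2: "square_integrable (\<lambda>x. indicator (-{-real k..real k}) x * g x)"
      by (rule sq; simp)+
    have "(\<lambda>x. e n x * g x) = (\<lambda>x. e n x * (indicator {-real k..real k} x * g x) +
       e n x * (indicator (-{-real k..real k}) x * g x))"
      by (auto simp: indicator_def)
    then have "(LINT x|lborel. e n x * g x) = (LINT x|lborel. e n x * (indicator {-real k..real k} x * g x)) +
      (LINT x|lborel. e n x * (indicator (-{-real k..real k}) x * g x))"
      using Bochner_Integration.integral_add[OF integrable_mult_L2[OF e s1] integrable_mult_L2[OF e s2]] by simp
    also have "cmod \<dots> \<le> cmod (LINT x|lborel. e n x * (indicator {-real k..real k} x * g x)) +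
       L2norm (e n) * L2norm (\<lambda>x. indicator (-{-real k..real k}) x * g x)"
      using Cauchy_Schwarz_L2[OF e s2] by (intro norm_triangle_le add_left_mono)
    also have "\<dots> \<le> cmod (LINT x|lborel. e n x * (indicator {-real k..real k} x * g x)) +
       M * L2norm (\<lambda>x. indicator (-{-real k..real k}) x * g x)"
      by (intro add_left_mono mult_right_mono e_le) simp
    finally show ?thesis .
  qed
  have "(\<lambda>n. LINT x|lborel. e n x * g x) \<longlonglongrightarrow> 0"
  proof (rule LIMSEQ_I)
    fix r :: real assume "r > 0"
    then have "r / (2 * M) > 0" using \<open>M > 0\<close> by simp
    from LIMSEQ_D[OF far this] obtain k where "L2norm (\<lambda>x. indicator (-{-real k..real k}) x * g x) < r / (2 * M)"
      by auto
    then have k: "M * L2norm (\<lambda>x. indicator (-{-real k..real k}) x * g x) < r / 2"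
      using \<open>M > 0\<close> by (simp add: field_simps)
    from LIMSEQ_D[OF near[of k], of "r / 2"] \<open>r > 0\<close> obtain n0 where n0:
      "\<forall>n\<ge>n0. cmod (LINT x|lborel. e n x * (indicator {-real k..real k} x * g x)) < r / 2"
      by auto
    then have "norm ((LINT x|lborel. e n x * g x) - 0) < r" if "n \<ge> n0" for n
    proof -
      have "cmod (LINT x|lborel. e n x * g x) < r / 2 + r / 2"
        by (rule le_less_trans[OF split[of n k] add_strict_mono[OF _ k]])
          (use that n0 in blast)
      then show ?thesis by simp
    qed
    then show "\<exists>n0. \<forall>n\<ge>n0. norm ((LINT x|lborel. e n x * g x) - 0) < r" by blast
  qed
  moreover have "(LINT x|lborel. e n x * g x) =
     (LINT x|lborel. diffq (inverse (real (Suc n))) f x * g x) - (LINT x|lborel. Dx f x * g x)" for n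
    unfolding e_def left_diff_distrib
    by (intro Bochner_Integration.integral_diff integrable_mult_L2 square_integrable_diffq f' g)
  ultimately show ?thesis by (simp add: LIM_zero_iff)
qed

section \<open>The weak equation\<close>


definition H1_continuous_at :: "(real \<Rightarrow> real \<Rightarrow> complex) \<Rightarrow> real \<Rightarrow> bool" where
  "H1_continuous_at F t \<longleftrightarrow>
     (\<forall>s. F s \<in> smooth_H1) \<and> ((\<lambda>s. H1norm (\<lambda>x. F s x - F t x)) \<longlongrightarrow> 0) (at t)"

lemma H1_continuous_atD:
  assumes "H1_continuous_at F t"
  shows "F s \<in> smooth_H1" "((\<lambda>s. H1norm (\<lambda>x. F s x - F t x)) \<longlongrightarrow> 0) (at t)"
  using assms by (auto simp: H1_continuous_at_def)

lemma H1_continuous_at_const: "f \<in> smooth_H1 \<Longrightarrow> H1_continuous_at (\<lambda>s. f) t"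
  by (simp add: H1_continuous_at_def H1norm_def L2norm_def Dx_const)

lemma H1_continuous_at_add:
  assumes F: "H1_continuous_at F t" and G: "H1_continuous_at G t"
  shows "H1_continuous_at (\<lambda>s x. F s x + G s x) t"
proof -
  note F' = H1_continuous_atD[OF F] and G' = H1_continuous_atD[OF G]
  have "((\<lambda>s. H1norm (\<lambda>x. F s x + G s x - (F t x + G t x))) \<longlongrightarrow> 0) (at t)"
  proof (rule tendsto_sandwich[OF _ _ tendsto_const])
    have "H1norm (\<lambda>x. F s x + G s x - (F t x + G t x)) \<le>
       H1norm (\<lambda>x. F s x - F t x) + H1norm (\<lambda>x. G s x - G t x)" for s
      using H1norm_triangle[OF smooth_H1_diff[OF F'(1)[of s] F'(1)[of t]] smooth_H1_diff[OF G'(1)[of s] G'(1)[of t]]]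
      by (simp add: algebra_simps)
    then show "\<forall>\<^sub>F s in at t. H1norm (\<lambda>x. F s x + G s x - (F t x + G t x)) \<le>
       H1norm (\<lambda>x. F s x - F t x) + H1norm (\<lambda>x. G s x - G t x)" by simp
    show "((\<lambda>s. H1norm (\<lambda>x. F s x - F t x) + H1norm (\<lambda>x. G s x - G t x)) \<longlongrightarrow> 0) (at t)"
      using tendsto_add[OF F'(2) G'(2)] by simp
  qed simp
  then show ?thesis
    by (simp add: H1_continuous_at_def smooth_H1_add F' G')
qed

lemma H1_continuous_at_norm:
  assumes F: "H1_continuous_at F t"
  shows "isCont (\<lambda>s. H1norm (F s)) t"
proof -
  note F' = H1_continuous_atD[OF F]
  have "((\<lambda>s. H1norm (F s) - H1norm (F t)) \<longlongrightarrow> 0) (at t)"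
    by (rule Lim_null_comparison[OF _ F'(2)]) (simp add: H1norm_diff_triangle F'(1))
  then show ?thesis by (simp add: isCont_def LIM_zero_iff)
qed

lemma H1_continuous_at_mult:
  assumes F: "H1_continuous_at F t" and G: "H1_continuous_at G t"
  shows "H1_continuous_at (\<lambda>s x. F s x * G s x) t"
proof -
  note F' = H1_continuous_atD[OF F] and G' = H1_continuous_atD[OF G]
  have "((\<lambda>s. H1norm (\<lambda>x. F s x * G s x - F t x * G t x)) \<longlongrightarrow> 0) (at t)"
  proof (rule tendsto_sandwich[OF _ _ tendsto_const])
    have "H1norm (\<lambda>x. F s x * G s x - F t x * G t x) \<le>
       3 * (H1norm (\<lambda>x. F s x - F t x) * H1norm (G s)) + 3 * (H1norm (F t) * H1norm (\<lambda>x. G s x - G t x))" for s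
    proof -
      have dF: "(\<lambda>x. F s x - F t x) \<in> smooth_H1" and dG: "(\<lambda>x. G s x - G t x) \<in> smooth_H1"
        by (intro smooth_H1_diff F'(1) G'(1))+
      have "(\<lambda>x. F s x * G s x - F t x * G t x) =
          (\<lambda>x. (F s x - F t x) * G s x + F t x * (G s x - G t x))"
        by (simp add: algebra_simps)
      then show ?thesis
        using H1norm_triangle[OF smooth_H1_mult(1)[OF dF G'(1)[of s]] smooth_H1_mult(1)[OF F'(1)[of t] dG]]
          smooth_H1_mult(2)[OF dF G'(1)[of s]] smooth_H1_mult(2)[OF F'(1)[of t] dG] by simp
    qed
    then show "\<forall>\<^sub>F s in at t. H1norm (\<lambda>x. F s x * G s x - F t x * G t x) \<le>
       3 * (H1norm (\<lambda>x. F s x - F t x) * H1norm (G s)) + 3 * (H1norm (F t) * H1norm (\<lambda>x. G s x - G t x))"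
      by simp
    have "((\<lambda>s. 3 * (H1norm (\<lambda>x. F s x - F t x) * H1norm (G s)) + 3 * (H1norm (F t) * H1norm (\<lambda>x. G s x - G t x)))
       \<longlongrightarrow> 3 * (0 * H1norm (G t)) + 3 * (H1norm (F t) * 0)) (at t)"
      using H1_continuous_at_norm[OF G] unfolding isCont_def by (intro tendsto_intros F'(2) G'(2))
    then show "((\<lambda>s. 3 * (H1norm (\<lambda>x. F s x - F t x) * H1norm (G s)) + 3 * (H1norm (F t) * H1norm (\<lambda>x. G s x - G t x)))
       \<longlongrightarrow> 0) (at t)" by simp
  qed simp
  then show ?thesis
    by (simp add: H1_continuous_at_def smooth_H1_mult F' G')
qed

lemma H1_continuous_at_cmult:
  assumes F: "H1_continuous_at F t"
  shows "H1_continuous_at (\<lambda>s x. c * F s x) t"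
proof -
  note F' = H1_continuous_atD[OF F]
  have "H1norm (\<lambda>x. c * F s x - c * F t x) = cmod c * H1norm (\<lambda>x. F s x - F t x)" for s
    using H1norm_cmult[OF smooth_H1D(1)[OF smooth_H1_diff[OF F'(1)[of s] F'(1)[of t]]], of c]
    by (simp add: right_diff_distrib)
  then show ?thesis
    using tendsto_mult_left[OF F'(2), of "cmod c"] by (simp add: H1_continuous_at_def smooth_H1_cmult F')
qed

lemma H1_continuous_at_cnj:
  assumes F: "H1_continuous_at F t"
  shows "H1_continuous_at (\<lambda>s x. cnj (F s x)) t"
proof -
  note F' = H1_continuous_atD[OF F]
  have "H1norm (\<lambda>x. cnj (F s x) - cnj (F t x)) = H1norm (\<lambda>x. F s x - F t x)" for s
    using H1norm_cnj[OF smooth_H1D(1)[OF smooth_H1_diff[OF F'(1)[of s] F'(1)[of t]]]] by simp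
  then show ?thesis
    using F'(2) by (simp add: H1_continuous_at_def smooth_H1_cnj F')
qed

lemma H1_continuous_at_shift:
  assumes F: "H1_continuous_at F t"
  shows "H1_continuous_at (\<lambda>s x. F s (d + x)) t"
proof -
  note F' = H1_continuous_atD[OF F]
  have "H1norm (\<lambda>x. F s (d + x) - F t (d + x)) = H1norm (\<lambda>x. F s x - F t x)" for s
    using H1norm_shift[OF smooth_H1D(1)[OF smooth_H1_diff[OF F'(1)[of s] F'(1)[of t]]]] by simp
  then show ?thesis
    using F'(2) by (simp add: H1_continuous_at_def smooth_H1_shift F')
qed

lemma H1_continuous_at_diffq:
  assumes F: "H1_continuous_at F t"
  shows "H1_continuous_at (\<lambda>s. diffq d (F s)) t"
proof -
  have "H1_continuous_at (\<lambda>s x. complex_of_real (inverse (2 * d)) * (F s (d + x) + - 1 * F s (- d + x))) t"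
    by (intro H1_continuous_at_cmult H1_continuous_at_add H1_continuous_at_shift F)
  then show ?thesis
    by (simp add: diffq_def[abs_def])
qed

section \<open>The equation tested against H^1 functions, and a chain rule\<close>

locale dnls_flow =
  fixes \<epsilon> :: real and u :: "real \<Rightarrow> real \<Rightarrow> complex"
  assumes sol: "dnls_solution \<epsilon> u"
begin

text \<open>The square of the modulus is written as u times its conjugate, so that the closure rules
  for products and conjugates apply to smoothness, derivatives and H^1 continuity.\<close>

definition nonlin :: "real \<Rightarrow> real \<Rightarrow> complex" where
  "nonlin t x = of_real \<epsilon> * (u t x * cnj (u t x) * u t x)"

definition flux :: "real \<Rightarrow> real \<Rightarrow> complex" where
  "flux t x = \<i> * Dx (u t) x + nonlin t x"

lemma u_H1: "u t \<in> smooth_H1"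
  using sol by (simp add: dnls_solution_def)

lemmas u_props = smooth_H1D[OF u_H1]

lemma u_continuous: "H1_continuous_at u t"
proof -
  have int: "integrable lborel (\<lambda>x. (cmod (f x))\<^sup>2)" "integrable lborel (\<lambda>x. (cmod (Dx f x))\<^sup>2)"
    if "f \<in> smooth_H1" for f using smooth_H1D[OF that] by (auto simp: square_integrable_def)
  \<comment> \<open>Each of the two L^2 norms is at most \<open>H1_norm f\<close>, whence the
    2.\<close>
  have le: "H1norm f \<le> 2 * H1_norm f" if "f \<in> smooth_H1" for f
    using int[OF that] unfolding H1norm_def L2norm_def H1_norm_def
    by (simp add: integral_nonneg_AE) (smt (verit) integral_nonneg_AE AE_I2 real_sqrt_le_mono zero_le_power2)
  have "((\<lambda>s. H1norm (\<lambda>x. u s x - u t x)) \<longlongrightarrow> 0) (at t)"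
  proof (rule tendsto_sandwich[OF _ _ tendsto_const])
    show "\<forall>\<^sub>F s in at t. H1norm (\<lambda>x. u s x - u t x) \<le> 2 * H1_norm (\<lambda>x. u s x - u t x)"
      by (simp add: le smooth_H1_diff u_H1)
    show "((\<lambda>s. 2 * H1_norm (\<lambda>x. u s x - u t x)) \<longlongrightarrow> 0) (at t)"
      using sol by (intro tendsto_mult_right_zero) (simp add: dnls_solution_def)
  qed simp
  then show ?thesis by (simp add: H1_continuous_at_def u_H1)
qed

lemma nonlin_continuous: "H1_continuous_at nonlin t"
  unfolding nonlin_def[abs_def]
  by (intro H1_continuous_at_cmult H1_continuous_at_mult H1_continuous_at_cnj u_continuous)

lemma nonlin_H1: "nonlin t \<in> smooth_H1"
  using H1_continuous_atD(1)[OF nonlin_continuous] .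

lemmas nonlin_props = smooth_H1D[OF nonlin_H1]

lemma flux_smooth: "smooth (flux t)"
  unfolding flux_def[abs_def] by (intro smooth_add smooth_mult smooth_const u_props nonlin_props)

lemma flux_L2: "square_integrable (flux t)"
  unfolding flux_def[abs_def] by (intro square_integrable_add square_integrable_cmult u_props nonlin_props)

lemma flux_continuous: "((\<lambda>s. L2norm (\<lambda>x. flux s x - flux t x)) \<longlongrightarrow> 0) (at t)"
proof (rule tendsto_sandwich[OF _ _ tendsto_const])
  have "L2norm (\<lambda>x. flux s x - flux t x) \<le> H1norm (\<lambda>x. u s x - u t x) + H1norm (\<lambda>x. nonlin s x - nonlin t x)" for s
  proof -
    have "L2norm (\<lambda>x. flux s x - flux t x) = L2norm (\<lambda>x. \<i> * (Dx (u s) x - Dx (u t) x) + (nonlin s x - nonlin t x))"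
      by (simp add: flux_def algebra_simps)
    also have "\<dots> \<le> L2norm (\<lambda>x. \<i> * (Dx (u s) x - Dx (u t) x)) + L2norm (\<lambda>x. nonlin s x - nonlin t x)"
      by (intro L2norm_triangle square_integrable_cmult square_integrable_diff u_props nonlin_props)
    also have "L2norm (\<lambda>x. \<i> * (Dx (u s) x - Dx (u t) x)) = L2norm (Dx (\<lambda>x. u s x - u t x))"
      by (simp add: L2norm_cmult Dx_diff u_props)
    also have "\<dots> + L2norm (\<lambda>x. nonlin s x - nonlin t x) \<le>
      H1norm (\<lambda>x. u s x - u t x) + H1norm (\<lambda>x. nonlin s x - nonlin t x)"
      by (intro add_mono L2norm_le_H1norm)
    finally show ?thesis .
  qed
  then show "\<forall>\<^sub>F s in at t. L2norm (\<lambda>x. flux s x - flux t x) \<le>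
    H1norm (\<lambda>x. u s x - u t x) + H1norm (\<lambda>x. nonlin s x - nonlin t x)" by simp
  show "((\<lambda>s. H1norm (\<lambda>x. u s x - u t x) + H1norm (\<lambda>x. nonlin s x - nonlin t x)) \<longlongrightarrow> 0) (at t)"
    using tendsto_add[OF H1_continuous_atD(2)[OF u_continuous] H1_continuous_atD(2)[OF nonlin_continuous]] by simp
qed simp

text \<open>The second derivative of u is known only to be smooth, not square integrable. Moving one
  derivative onto the compactly supported \<phi> leaves the flux, which lies in L^2; in this form
  the identity can be extended to H^1 functions.\<close>

lemma weak_equation:
  assumes \<phi>: "test_function \<phi>"
  shows "((\<lambda>s. LINT x|lborel. u s x * \<phi> x) has_vector_derivative
    - (LINT x|lborel. flux t x * Dx \<phi> x)) (at t)"
proof -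
  obtain d where d: "((\<lambda>s. LINT x|lborel. u s x * \<phi> x) has_vector_derivative d) (at t)"
    and eq: "\<i> * d + (LINT x|lborel.
                (Dx (Dx (u t)) x
                  - \<i> * complex_of_real \<epsilon> * Dx (\<lambda>y. complex_of_real ((cmod (u t y))\<^sup>2) * u t y) x)
                * \<phi> x) = 0"
    using sol \<phi> unfolding dnls_solution_def by blast
  have s\<phi>: "smooth \<phi>" using \<phi> by (simp add: test_function_def)
  obtain R where R: "\<forall>x\<in>{x. \<phi> x \<noteq> 0}. norm x \<le> R"
    using \<phi> unfolding test_function_def bounded_iff by blast
  \<comment> \<open>R bounds the points where \<phi> is nonzero, possibly attained; R + 1 makes the
    non-strict form valid.\<close>
  have zero: "\<phi> x = 0" if "\<bar>x\<bar> \<ge> R + 1" for x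
    using that R by (cases "\<phi> x = 0") auto
  have zero': "Dx \<phi> x = 0" if "\<bar>x\<bar> > R + 1" for x
    using Dx_eq_0_outside[of "R + 1" \<phi>] zero that by blast
  have sm: "smooth (\<lambda>x. u t x * cnj (u t x) * u t x)"
    by (intro smooth_mult smooth_cnj u_props)
  have "(\<lambda>y. complex_of_real ((cmod (u t y))\<^sup>2) * u t y) = (\<lambda>x. u t x * cnj (u t x) * u t x)"
    by (simp add: complex_norm_square del: of_real_power)
  moreover have "Dx (flux t) = (\<lambda>x. \<i> * Dx (Dx (u t)) x + of_real \<epsilon> * Dx (\<lambda>x. u t x * cnj (u t x) * u t x) x)"
  proof -
    have "Dx (\<lambda>x. \<i> * Dx (u t) x) = (\<lambda>x. \<i> * Dx (Dx (u t)) x)"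
      by (rule Dx_cmult[OF u_props(4)])
    moreover have "Dx (nonlin t) = (\<lambda>x. of_real \<epsilon> * Dx (\<lambda>x. u t x * cnj (u t x) * u t x) x)"
      unfolding nonlin_def[abs_def] by (rule Dx_cmult[OF sm])
    ultimately show ?thesis
      using Dx_add[OF smooth_mult[OF smooth_const u_props(4)] nonlin_props(1), of \<i> t t]
      by (simp add: flux_def[abs_def])
  qed
  ultimately have "(\<lambda>x. (Dx (Dx (u t)) x
                  - \<i> * complex_of_real \<epsilon> * Dx (\<lambda>y. complex_of_real ((cmod (u t y))\<^sup>2) * u t y) x)
                * \<phi> x) = (\<lambda>x. - \<i> * (Dx (flux t) x * \<phi> x))"
    by (simp add: algebra_simps)
  with eq have "\<i> * d + (LINT x|lborel. - \<i> * (Dx (flux t) x * \<phi> x)) = 0" by simp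
  then have "\<i> * (d - (LINT x|lborel. Dx (flux t) x * \<phi> x)) = 0"
    by (simp add: algebra_simps)
  then have d': "d = (LINT x|lborel. Dx (flux t) x * \<phi> x)" by simp
  have "(LINT x|lborel. Dx (\<lambda>x. flux t x * \<phi> x) x) = 0"
    by (rule integral_Dx_compact_support[of _ "R + 1"]) (auto intro: smooth_mult flux_smooth s\<phi> simp: zero)
  moreover have "integrable lborel (\<lambda>x. flux t x * Dx \<phi> x)" "integrable lborel (\<lambda>x. Dx (flux t) x * \<phi> x)"
    by (rule compact_support_integrable[of _ "R + 1"],
        intro smooth_continuous smooth_mult smooth_Dx flux_smooth s\<phi>, simp add: zero zero')+
  ultimately have "(LINT x|lborel. flux t x * Dx \<phi> x) + (LINT x|lborel. Dx (flux t) x * \<phi> x) = 0"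
    by (simp add: Dx_mult flux_smooth s\<phi>)
  with d' have "d = - (LINT x|lborel. flux t x * Dx \<phi> x)"
    by (simp only: eq_neg_iff_add_eq_0 add.commute)
  with d show ?thesis by simp
qed

text \<open>First-order expansion of u in H^-1, with G the flux: tested against \<phi>, the error
  u(s) - u(t) - (s - t) \<partial>_x G(t) is bounded through the L^2 norm of \<phi>' alone. This
  uniformity is what later permits a \<phi> that depends on s. For test functions it is the mean
  value inequality; cutoffs extend it to H^1.\<close>

lemma increment_estimate:
  assumes \<phi>: "\<phi> \<in> smooth_H1"
    and \<eta>: "\<And>r. r \<in> closed_segment t s \<Longrightarrow> L2norm (\<lambda>x. flux r x - flux t x) \<le> \<eta>"
  shows "cmod ((LINT x|lborel. (u s x - u t x) * \<phi> x) + of_real (s - t) * (LINT x|lborel. flux t x * Dx \<phi> x))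
    \<le> \<eta> * L2norm (Dx \<phi>) * \<bar>s - t\<bar>"
proof -
  have test: "cmod ((LINT x|lborel. (u s x - u t x) * \<psi> x) + of_real (s - t) * (LINT x|lborel. flux t x * Dx \<psi> x))
    \<le> \<eta> * L2norm (Dx \<psi>) * \<bar>s - t\<bar>" if \<psi>: "test_function \<psi>" for \<psi>
  proof -
    note \<psi>' = smooth_H1D[OF test_function_smooth_H1[OF \<psi>]]
    define c where "c = (LINT x|lborel. flux t x * Dx \<psi> x)"
    \<comment> \<open>The added linear term makes the derivative at r a pairing with the difference
      of the fluxes at r and t.\<close>
    define f where "f r = (LINT x|lborel. u r x * \<psi> x) + r *\<^sub>R c" for r
    have "cmod (f s - f t) \<le> (\<eta> * L2norm (Dx \<psi>)) * \<bar>s - t\<bar>"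
    proof (rule norm_diff_le_vector_derivative[where S="closed_segment t s"
          and f'="\<lambda>r. - (LINT x|lborel. flux r x * Dx \<psi> x) + c"])
      show "(f has_vector_derivative - (LINT x|lborel. flux r x * Dx \<psi> x) + c) (at r)" for r
        unfolding f_def by (rule has_vector_derivative_add[OF weak_equation[OF \<psi>]])
          (auto intro!: derivative_eq_intros)
      fix r assume r: "r \<in> closed_segment t s"
      have "- (LINT x|lborel. flux r x * Dx \<psi> x) + c = - (LINT x|lborel. (flux r x - flux t x) * Dx \<psi> x)"
        unfolding c_def left_diff_distrib
        by (subst Bochner_Integration.integral_diff) (auto intro: integrable_mult_L2 flux_L2 \<psi>')
      then have "norm (- (LINT x|lborel. flux r x * Dx \<psi> x) + c) \<le> L2norm (\<lambda>x. flux r x - flux t x) * L2norm (Dx \<psi>)"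
        using Cauchy_Schwarz_L2[OF square_integrable_diff[OF flux_L2[of r] flux_L2[of t]] \<psi>'(3)] by simp
      also have "\<dots> \<le> \<eta> * L2norm (Dx \<psi>)"
        by (intro mult_right_mono \<eta> r) simp
      finally show "norm (- (LINT x|lborel. flux r x * Dx \<psi> x) + c) \<le> \<eta> * L2norm (Dx \<psi>)" .
    qed auto
    moreover have "f s - f t = (LINT x|lborel. (u s x - u t x) * \<psi> x) + of_real (s - t) * c"
    proof -
      have "(LINT x|lborel. (u s x - u t x) * \<psi> x) = (LINT x|lborel. u s x * \<psi> x) - (LINT x|lborel. u t x * \<psi> x)"
        unfolding left_diff_distrib
        by (intro Bochner_Integration.integral_diff integrable_mult_L2 u_props \<psi>')
      then show ?thesis by (simp add: f_def scaleR_conv_of_real algebra_simps)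
    qed
    ultimately show ?thesis by (simp add: c_def)
  qed
  define \<phi>n where "\<phi>n n = (\<lambda>x. cutoff n x * \<phi> x)" for n
  have \<phi>n: "\<phi>n n \<in> smooth_H1" for n
    unfolding \<phi>n_def by (intro smooth_H1_mult cutoff_smooth_H1 \<phi>)
  note \<phi>' = smooth_H1D[OF \<phi>] and \<phi>n' = smooth_H1D[OF \<phi>n]
  have lim: "(\<lambda>n. H1norm (\<lambda>x. \<phi>n n x - \<phi> x)) \<longlonglongrightarrow> 0"
    unfolding \<phi>n_def by (rule cutoff_mult_tendsto_H1[OF \<phi>])
  have lim0: "(\<lambda>n. L2norm (\<lambda>x. \<phi>n n x - \<phi> x)) \<longlonglongrightarrow> 0"
    by (rule tendsto_sandwich[OF _ _ tendsto_const lim]) (simp_all add: L2norm_le_H1norm)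
  have lim1: "(\<lambda>n. L2norm (\<lambda>x. Dx (\<phi>n n) x - Dx \<phi> x)) \<longlonglongrightarrow> 0"
    by (rule tendsto_sandwich[OF _ _ tendsto_const lim])
      (simp_all add: L2norm_le_H1norm Dx_diff[symmetric] \<phi>' \<phi>n')
  have "(\<lambda>n. L2norm (Dx (\<phi>n n)) - L2norm (Dx \<phi>)) \<longlonglongrightarrow> 0"
    by (rule Lim_null_comparison[OF _ lim1]) (simp add: L2norm_diff_triangle \<phi>' \<phi>n')
  then have "(\<lambda>n. L2norm (Dx (\<phi>n n))) \<longlonglongrightarrow> L2norm (Dx \<phi>)" by (simp add: LIM_zero_iff)
  then have R: "(\<lambda>n. \<eta> * L2norm (Dx (\<phi>n n)) * \<bar>s - t\<bar>) \<longlonglongrightarrow> \<eta> * L2norm (Dx \<phi>) * \<bar>s - t\<bar>"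
    by (intro tendsto_intros)
  have L: "(\<lambda>n. cmod ((LINT x|lborel. (u s x - u t x) * \<phi>n n x) + of_real (s - t) * (LINT x|lborel. flux t x * Dx (\<phi>n n) x)))
    \<longlonglongrightarrow> cmod ((LINT x|lborel. (u s x - u t x) * \<phi> x) + of_real (s - t) * (LINT x|lborel. flux t x * Dx \<phi> x))"
    by (intro tendsto_intros integral_mult_tendsto lim0 lim1 \<phi>' \<phi>n' flux_L2 square_integrable_diff u_props)
  show ?thesis
    using test[OF test_function_cutoff_mult[OF \<phi>'(1)]]
    by (intro LIMSEQ_le[OF L R]) (auto simp: \<phi>n_def)
qed

text \<open>Taking \<Phi>(s) itself as the test function in \<open>increment_estimate\<close> gives
  the increment of F as -(s - t) Re \<integral> G(t) \<partial>_x \<Phi>(s) up to o(|s - t|), with G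
  the flux, and H^1 continuity replaces \<Phi>(s) by \<Phi>(t). The second hypothesis is an exact
  divided difference, so no term quadratic in u(s) - u(t) appears.\<close>

lemma functional_derivative:
  assumes \<Phi>: "H1_continuous_at \<Phi> t"
    and F: "\<And>s. F s - F t = Re (LINT x|lborel. (u s x - u t x) * \<Phi> s x)"
  shows "(F has_real_derivative - Re (LINT x|lborel. flux t x * Dx (\<Phi> t) x)) (at t)"
proof -
  note \<Phi>' = H1_continuous_atD[OF \<Phi>] and \<Phi>'' = smooth_H1D[OF H1_continuous_atD(1)[OF \<Phi>]]
  define D where "D = - Re (LINT x|lborel. flux t x * Dx (\<Phi> t) x)"
  \<comment> \<open>Bounds the derivative of \<Phi>(s) in L^2 as soon as \<Phi>(s) is within H^1
    distance 1 of \<Phi>(t).\<close>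
  define K where "K = L2norm (Dx (\<Phi> t)) + 1"
  have K: "K > 0" by (simp add: K_def add_nonneg_pos)
  have diff_le: "L2norm (\<lambda>x. Dx (\<Phi> s) x - Dx (\<Phi> t) x) \<le> H1norm (\<lambda>x. \<Phi> s x - \<Phi> t x)" for s
    using L2norm_le_H1norm(2)[of "\<lambda>x. \<Phi> s x - \<Phi> t x"] by (simp add: Dx_diff \<Phi>'')
  have "((\<lambda>s. (F s - F t) / (s - t)) \<longlongrightarrow> D) (at t)"
  proof (rule tendstoI)
    fix e :: real assume e: "e > 0"
    \<comment> \<open>Makes the error of the expansion at most e / 2 per unit time; the other half
      is spent on replacing \<Phi>(s) by \<Phi>(t).\<close>
    define \<eta> where "\<eta> = e / (2 * K)"
    have \<eta>: "\<eta> > 0" using e K by (simp add: \<eta>_def)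
    from tendstoD[OF flux_continuous[of t] \<eta>] obtain \<delta> where \<delta>: "\<delta> > 0"
      "\<And>r. r \<noteq> t \<Longrightarrow> dist r t < \<delta> \<Longrightarrow> L2norm (\<lambda>x. flux r x - flux t x) < \<eta>"
      by (auto simp: eventually_at)
    have ev1: "\<forall>\<^sub>F s in at t. dist s t < \<delta>"
      using \<delta>(1) by (auto simp: eventually_at)
    have ev2: "\<forall>\<^sub>F s in at t. H1norm (\<lambda>x. \<Phi> s x - \<Phi> t x) < 1"
      using order_tendstoD(2)[OF \<Phi>'(2), of 1] by simp
    have "((\<lambda>s. L2norm (flux t) * H1norm (\<lambda>x. \<Phi> s x - \<Phi> t x)) \<longlongrightarrow> L2norm (flux t) * 0) (at t)"
      by (intro tendsto_intros \<Phi>'(2))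
    then have ev3: "\<forall>\<^sub>F s in at t. L2norm (flux t) * H1norm (\<lambda>x. \<Phi> s x - \<Phi> t x) < e / 2"
      using order_tendstoD(2)[of _ 0 "at t" "e / 2"] e by simp
    have ev4: "\<forall>\<^sub>F s in at t. s \<noteq> t" by (simp add: eventually_at_filter)
    from ev1 ev2 ev3 ev4 show "\<forall>\<^sub>F s in at t. dist ((F s - F t) / (s - t)) D < e"
    proof eventually_elim
      case (elim s)
      define A where "A = (LINT x|lborel. (u s x - u t x) * \<Phi> s x) + of_real (s - t) * (LINT x|lborel. flux t x * Dx (\<Phi> s) x)"
      define B where "B = (LINT x|lborel. flux t x * (Dx (\<Phi> s) x - Dx (\<Phi> t) x))"
      have "cmod A \<le> \<eta> * L2norm (Dx (\<Phi> s)) * \<bar>s - t\<bar>"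
        unfolding A_def
      proof (rule increment_estimate[OF \<Phi>'(1)])
        fix r assume "r \<in> closed_segment t s"
        then have "dist r t < \<delta>"
          using elim(1) dist_in_closed_segment[of r t s] by (simp add: dist_commute)
        \<comment> \<open>The punctured limit at t says nothing about r = t, where the difference is
          zero.\<close>
        then show "L2norm (\<lambda>x. flux r x - flux t x) \<le> \<eta>"
          using \<delta>(2)[of r] \<eta> by (cases "r = t") (auto simp: L2norm_def)
      qed
      also have "\<dots> \<le> \<eta> * K * \<bar>s - t\<bar>"
      proof -
        have "L2norm (Dx (\<Phi> s)) \<le> K"
          using L2norm_diff_triangle[OF \<Phi>''(3)[of s] \<Phi>''(3)[of t]] diff_le[of s] elim(2) by (simp add: K_def)
        then show ?thesis using \<eta> by (intro mult_right_mono mult_left_mono) auto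
      qed
      also have "\<eta> * K = e / 2" using K by (simp add: \<eta>_def)
      finally have A: "cmod A \<le> e / 2 * \<bar>s - t\<bar>" .
      have "cmod B \<le> L2norm (flux t) * L2norm (\<lambda>x. Dx (\<Phi> s) x - Dx (\<Phi> t) x)"
        unfolding B_def by (intro Cauchy_Schwarz_L2 flux_L2 square_integrable_diff \<Phi>'')
      also have "\<dots> \<le> L2norm (flux t) * H1norm (\<lambda>x. \<Phi> s x - \<Phi> t x)"
        by (intro mult_left_mono diff_le) simp
      finally have B: "cmod B < e / 2" using elim(3) by simp
      have "B = (LINT x|lborel. flux t x * Dx (\<Phi> s) x) - (LINT x|lborel. flux t x * Dx (\<Phi> t) x)"
        unfolding B_def right_diff_distrib
        by (intro Bochner_Integration.integral_diff integrable_mult_L2 flux_L2 \<Phi>'')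
      moreover have alg: "Re J - - Re I * (s - t) = Re (J + of_real (s - t) * I' - of_real (s - t) * (I' - I))"
        for J I I' by (simp add: algebra_simps)
      ultimately have "F s - F t - D * (s - t) = Re (A - of_real (s - t) * B)"
        unfolding F D_def A_def by (simp only: alg)
      then have "\<bar>F s - F t - D * (s - t)\<bar> \<le> cmod (A - of_real (s - t) * B)"
        by (simp only: abs_Re_le_cmod)
      also have "\<dots> \<le> cmod A + \<bar>s - t\<bar> * cmod B"
        using norm_triangle_ineq4[of A "of_real (s - t) * B"] by (simp only: norm_mult norm_of_real)
      also have "\<dots> < e / 2 * \<bar>s - t\<bar> + \<bar>s - t\<bar> * (e / 2)"
        using A B elim(4) by (intro add_le_less_mono mult_strict_left_mono) auto
      finally have "\<bar>F s - F t - D * (s - t)\<bar> < e * \<bar>s - t\<bar>" by (simp add: mult.commute)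
      moreover have "(F s - F t) / (s - t) - D = (F s - F t - D * (s - t)) / (s - t)"
        using elim(4) by (simp add: field_simps)
      ultimately show ?case
        using elim(4) by (simp add: dist_real_def abs_divide pos_divide_less_eq)
    qed
  qed
  then show ?thesis by (simp add: has_field_derivative_iff D_def)
qed

end

section \<open>Energy conservation and the weighted mass\<close>


lemma of_real_cmod_power4: "complex_of_real ((cmod z) ^ 4) = (z * cnj z) * (z * cnj z)"
  unfolding complex_norm_square[symmetric] of_real_mult[symmetric] by (simp flip: power_add)

context dnls_flow
begin

definition quartic :: "real \<Rightarrow> real" where
  "quartic t = (LINT x|lborel. (cmod (u t x)) ^ 4)"

lemma nonlin_cnj_u: "nonlin t x * cnj (u t x) = of_real (\<epsilon> * (cmod (u t x)) ^ 4)"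
  by (simp add: nonlin_def of_real_cmod_power4 mult_ac del: of_real_power)

lemma integrable_quartic: "integrable lborel (\<lambda>x. (cmod (u t x)) ^ 4)"
proof -
  have "integrable lborel (\<lambda>x. complex_of_real ((cmod (u t x)) ^ 4))"
    unfolding of_real_cmod_power4
    by (intro integrable_mult_L2 smooth_H1D(2)[OF smooth_H1_mult(1)] smooth_H1_cnj u_H1)
  then have "integrable lborel (\<lambda>x. Re (complex_of_real ((cmod (u t x)) ^ 4)))" by (rule integrable_Re)
  then show ?thesis by simp
qed

text \<open>The quadratic part of the energy is regularised by replacing \<open>\<partial>\<^sub>x\<close> with a difference quotient.\<close>

definition energy_quotient :: "real \<Rightarrow> real \<Rightarrow> real" where
  "energy_quotient d t = Re (LINT x|lborel. u t x * (- \<i> * diffq d (\<lambda>x. cnj (u t x)) x))"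

text \<open>Skewness of the quotient makes the regularised energy a symmetric quadratic form, so its
  gradient is twice \<open>V\<close>. Paired with the dispersive part of the flux it gives a purely
  imaginary integral, and only the nonlinear part survives.\<close>

lemma energy_quotient_derivative:
  "(energy_quotient d has_real_derivative
     - 2 * Re (\<i> * (LINT x|lborel. diffq d (nonlin t) x * cnj (Dx (u t) x)))) (at t)"
proof -
  define V where "V s x = - \<i> * diffq d (\<lambda>x. cnj (u s x)) x" for s x
  \<comment> \<open>For a symmetric form, Q(s) - Q(t) is the pairing of u(s) - u(t) with
    \<open>V s + V t\<close>; the fact \<open>sym\<close> cancels the cross terms.\<close>
  define \<Phi> where "\<Phi> s x = V s x + V t x" for s x
  have Vc: "H1_continuous_at V t" for t
    unfolding V_def[abs_def] by (intro H1_continuous_at_cmult H1_continuous_at_diffq H1_continuous_at_cnj u_continuous)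
  note V' = smooth_H1D[OF H1_continuous_atD(1)[OF Vc]]
  have \<Phi>: "H1_continuous_at \<Phi> t"
    unfolding \<Phi>_def[abs_def] by (intro H1_continuous_at_add Vc H1_continuous_at_const H1_continuous_atD(1)[OF Vc])
  have sym: "Re (LINT x|lborel. u a x * V b x) = Re (LINT x|lborel. u b x * V a x)" for a b
  proof -
    have "(LINT x|lborel. u a x * V b x) = - \<i> * (LINT x|lborel. u a x * diffq d (\<lambda>x. cnj (u b x)) x)"
      by (simp add: V_def mult.left_commute[of _ \<i>])
    also have "\<dots> = \<i> * (LINT x|lborel. diffq d (u a) x * cnj (u b x))"
      by (subst integral_diffq) (auto intro: u_props square_integrable_cnj)
    also have "\<dots> = (LINT x|lborel. cnj (u b x * V a x))"
      by (simp add: V_def diffq_cnj mult_ac)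
    also have "\<dots> = cnj (LINT x|lborel. u b x * V a x)"
      by (rule Bochner_Integration.integral_cnj)
    finally show ?thesis by simp
  qed
  have eq: "energy_quotient d s = Re (LINT x|lborel. u s x * V s x)" for s
    unfolding energy_quotient_def V_def ..
  have F: "energy_quotient d s - energy_quotient d t = Re (LINT x|lborel. (u s x - u t x) * \<Phi> s x)" for s
  proof -
    have int: "integrable lborel (\<lambda>x. u a x * V b x)" for a b
      by (intro integrable_mult_L2 u_props V')
    have "(LINT x|lborel. (u s x - u t x) * \<Phi> s x) =
      (LINT x|lborel. (u s x * V s x - u t x * V t x) + (u s x * V t x - u t x * V s x))"
      by (simp add: \<Phi>_def algebra_simps)
    also have "\<dots> = ((LINT x|lborel. u s x * V s x) - (LINT x|lborel. u t x * V t x))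
      + ((LINT x|lborel. u s x * V t x) - (LINT x|lborel. u t x * V s x))"
      using int by simp
    finally show ?thesis
      using sym[of s t] by (simp add: eq)
  qed
  define W where "W x = diffq d (\<lambda>x. cnj (Dx (u t) x)) x" for x
  have W: "square_integrable W"
    unfolding W_def[abs_def] by (intro square_integrable_diffq square_integrable_cnj u_props)
  have D\<Phi>: "Dx (\<Phi> t) = (\<lambda>x. - 2 * \<i> * W x)"
  proof -
    have "\<Phi> t = (\<lambda>x. - 2 * \<i> * diffq d (\<lambda>x. cnj (u t x)) x)"
      by (simp add: \<Phi>_def V_def fun_eq_iff)
    then have "Dx (\<Phi> t) = (\<lambda>x. - 2 * \<i> * Dx (diffq d (\<lambda>x. cnj (u t x))) x)"
      by (simp only: Dx_cmult smooth_H1D(1)[OF smooth_H1_diffq[OF smooth_H1_cnj[OF u_H1]]])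
    then show ?thesis
      by (simp add: Dx_diffq Dx_cnj smooth_cnj u_props W_def[abs_def])
  qed
  \<comment> \<open>The dispersive contribution. Skewness and compatibility with conjugation give Z
    = - cnj Z.\<close>
  define Z where "Z = (LINT x|lborel. Dx (u t) x * W x)"
  have "Z = - (LINT x|lborel. diffq d (Dx (u t)) x * cnj (Dx (u t) x))"
    unfolding Z_def W_def by (subst integral_diffq) (auto intro: u_props square_integrable_cnj)
  also have "\<dots> = - cnj Z"
    unfolding Z_def by (simp add: W_def diffq_cnj mult.commute flip: Bochner_Integration.integral_cnj)
  finally have Z: "Re Z = 0" by (metis complex_cnj_minus complex_cnj_cnj minus_complex.simps(1) cnj.simps(1) uminus_complex.simps(1) equal_neg_zero)
  have N: "(LINT x|lborel. nonlin t x * W x) = - (LINT x|lborel. diffq d (nonlin t) x * cnj (Dx (u t) x))"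
    unfolding W_def by (subst integral_diffq) (auto intro: u_props nonlin_props square_integrable_cnj)
  have "(LINT x|lborel. flux t x * Dx (\<Phi> t) x) =
    (LINT x|lborel. 2 * (Dx (u t) x * W x) + (- 2 * \<i>) * (nonlin t x * W x))"
    unfolding D\<Phi> flux_def by (simp add: algebra_simps)
  also have "\<dots> = 2 * Z + (- 2 * \<i>) * (LINT x|lborel. nonlin t x * W x)"
    unfolding Z_def
    by (subst Bochner_Integration.integral_add)
      (auto intro!: integrable_mult_right integrable_mult_L2 u_props nonlin_props W)
  finally have "- Re (LINT x|lborel. flux t x * Dx (\<Phi> t) x) =
     - 2 * Re (\<i> * (LINT x|lborel. diffq d (nonlin t) x * cnj (Dx (u t) x)))"
    using Z unfolding N by simp
  with functional_derivative[OF \<Phi> F] show ?thesis by simp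
qed

text \<open>The gradient is twice the conjugate of \<open>nonlin\<close>. Against the nonlinear part
  of the flux it contributes nothing; against the dispersive part it gives the term that
  \<open>energy_quotient_derivative\<close> has with opposite sign and a difference quotient in
  place of \<open>Dx\<close>.\<close>

lemma quartic_derivative:
  "((\<lambda>s. \<epsilon> / 2 * quartic s) has_real_derivative
     2 * Re (\<i> * (LINT x|lborel. Dx (nonlin t) x * cnj (Dx (u t) x)))) (at t)"
proof -
  \<comment> \<open>Factor |v|^4 - |w|^4 as (|v|^2 + |w|^2)(|v|^2 - |w|^2), and write the last
    factor as Re ((v - w)(cnj v + cnj w)).\<close>
  define \<Phi> where "\<Phi> s x = of_real (\<epsilon> / 2) * ((u s x * cnj (u s x) + u t x * cnj (u t x)) * (cnj (u s x) + cnj (u t x)))" for s x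
  have \<Phi>: "H1_continuous_at \<Phi> t"
    unfolding \<Phi>_def[abs_def]
    by (intro H1_continuous_at_add H1_continuous_at_mult H1_continuous_at_cmult H1_continuous_at_cnj
        u_continuous H1_continuous_at_const u_H1 smooth_H1_mult smooth_H1_cnj)
  note \<Phi>' = smooth_H1D[OF H1_continuous_atD(1)[OF \<Phi>]]
  have F: "\<epsilon> / 2 * quartic s - \<epsilon> / 2 * quartic t = Re (LINT x|lborel. (u s x - u t x) * \<Phi> s x)" for s
  proof -
    have int: "integrable lborel (\<lambda>x. (u s x - u t x) * \<Phi> s x)"
      by (intro integrable_mult_L2 square_integrable_diff u_props \<Phi>')
    have pt: "Re ((v - w) * (of_real (\<epsilon> / 2) * ((v * cnj v + w * cnj w) * (cnj v + cnj w)))) =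
      \<epsilon> / 2 * (cmod v ^ 4) - \<epsilon> / 2 * (cmod w ^ 4)" for v w
    proof -
      have c4: "cmod z ^ 4 = ((Re z)\<^sup>2 + (Im z)\<^sup>2)\<^sup>2" for z
        unfolding cmod_power2[symmetric] by (simp flip: power_mult)
      show ?thesis
        unfolding c4 by (simp add: power2_eq_square) (simp add: field_simps)
    qed
    have "Re (LINT x|lborel. (u s x - u t x) * \<Phi> s x) = (LINT x|lborel. Re ((u s x - u t x) * \<Phi> s x))"
      using int by (rule integral_Re[symmetric])
    also have "\<dots> = (LINT x|lborel. \<epsilon> / 2 * (cmod (u s x) ^ 4) - \<epsilon> / 2 * (cmod (u t x) ^ 4))"
      unfolding \<Phi>_def pt ..
    also have "\<dots> = \<epsilon> / 2 * quartic s - \<epsilon> / 2 * quartic t"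
      using integrable_quartic by (simp add: quartic_def)
    finally show ?thesis by simp
  qed
  have D\<Phi>: "Dx (\<Phi> t) = (\<lambda>x. 2 * cnj (Dx (nonlin t) x))"
  proof -
    have "\<Phi> t = (\<lambda>x. 2 * cnj (nonlin t x))"
      by (simp add: \<Phi>_def nonlin_def fun_eq_iff algebra_simps)
    then have "Dx (\<Phi> t) = (\<lambda>x. 2 * Dx (\<lambda>x. cnj (nonlin t x)) x)"
      by (simp only: Dx_cmult smooth_cnj nonlin_props)
    then show ?thesis by (simp add: Dx_cnj nonlin_props)
  qed
  \<comment> \<open>Its real part is half the integral of the derivative of
    |\<open>nonlin\<close>|^2, hence zero.\<close>
  define Z where "Z = (LINT x|lborel. nonlin t x * cnj (Dx (nonlin t) x))"
  have "Z = (LINT x|lborel. nonlin t x * Dx (\<lambda>x. cnj (nonlin t x)) x)"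
    by (simp add: Z_def Dx_cnj nonlin_props)
  also have "\<dots> = - (LINT x|lborel. Dx (nonlin t) x * cnj (nonlin t x))"
    by (intro smooth_H1_integral_by_parts nonlin_H1 smooth_H1_cnj)
  also have "\<dots> = - cnj Z"
    unfolding Z_def by (simp add: mult.commute flip: Bochner_Integration.integral_cnj)
  finally have Z: "Re Z = 0" by (metis complex_cnj_minus complex_cnj_cnj minus_complex.simps(1) cnj.simps(1) uminus_complex.simps(1) equal_neg_zero)
  define Y where "Y = (LINT x|lborel. Dx (nonlin t) x * cnj (Dx (u t) x))"
  have Y: "(LINT x|lborel. Dx (u t) x * cnj (Dx (nonlin t) x)) = cnj Y"
    unfolding Y_def by (simp add: mult.commute flip: Bochner_Integration.integral_cnj)
  have "(LINT x|lborel. flux t x * Dx (\<Phi> t) x) =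
    (LINT x|lborel. 2 * \<i> * (Dx (u t) x * cnj (Dx (nonlin t) x)) + 2 * (nonlin t x * cnj (Dx (nonlin t) x)))"
    unfolding D\<Phi> flux_def by (simp add: algebra_simps)
  also have "\<dots> = 2 * \<i> * cnj Y + 2 * Z"
    unfolding Z_def Y[symmetric]
    by (subst Bochner_Integration.integral_add)
      (auto intro!: integrable_mult_right integrable_mult_L2 square_integrable_cnj u_props nonlin_props)
  finally have "- Re (LINT x|lborel. flux t x * Dx (\<Phi> t) x) = 2 * Re (\<i> * Y)"
    using Z by simp
  with functional_derivative[OF \<Phi> F] show ?thesis by (simp add: Y_def)
qed

lemma energy_eq:
  "dnls_energy \<epsilon> (u t) = - Im (LINT x|lborel. cnj (u t x) * Dx (u t) x) + \<epsilon> / 2 * quartic t"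
  by (simp add: dnls_energy_def quartic_def)

text \<open>Skewness moves the quotient from the conjugate onto u; weak convergence against the
  fixed function cnj u then suffices.\<close>

lemma energy_quotient_tendsto:
  "(\<lambda>n. energy_quotient (inverse (real (Suc n))) t) \<longlonglongrightarrow> - Im (LINT x|lborel. cnj (u t x) * Dx (u t) x)"
proof -
  have "energy_quotient d t = Re (\<i> * (LINT x|lborel. diffq d (u t) x * cnj (u t x)))" for d
    unfolding energy_quotient_def
    by (subst integral_diffq) (auto intro: u_props square_integrable_cnj simp: mult.left_commute[of _ \<i>])
  moreover have "(\<lambda>n. Re (\<i> * (LINT x|lborel. diffq (inverse (real (Suc n))) (u t) x * cnj (u t x))))
     \<longlonglongrightarrow> Re (\<i> * (LINT x|lborel. Dx (u t) x * cnj (u t x)))"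
    by (intro tendsto_intros diffq_tendsto_Dx_weakly u_H1 square_integrable_cnj u_props)
  ultimately show ?thesis by (simp add: mult.commute)
qed

lemma H1norm_u_continuous: "continuous_on A (\<lambda>s. H1norm (u s))"
  and H1norm_nonlin_continuous: "continuous_on A (\<lambda>s. H1norm (nonlin s))"
  by (auto intro!: continuous_at_imp_continuous_on H1_continuous_at_norm u_continuous nonlin_continuous)

text \<open>The regularised energies are differentiable in time; the energy is reached only as their
  limit in the integrated identity on [a, b]. Their derivatives tend to 0 at each time and are
  dominated by a function continuous in time.\<close>

theorem energy_conservation: "dnls_energy \<epsilon> (u a) = dnls_energy \<epsilon> (u b)"
proof -
  have le: "dnls_energy \<epsilon> (u a) = dnls_energy \<epsilon> (u b)" if ab: "a \<le> b" for a b
  proof -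
    define d where "d n = inverse (real (Suc n))" for n
    have d: "d n > 0" for n by (simp add: d_def)
    define F where "F n s = energy_quotient (d n) s + \<epsilon> / 2 * quartic s" for n s
    define E where "E n s = - 2 * Re (\<i> * (LINT x|lborel. diffq (d n) (nonlin s) x * cnj (Dx (u s) x))) +
       2 * Re (\<i> * (LINT x|lborel. Dx (nonlin s) x * cnj (Dx (u s) x)))" for n s
    have sq: "square_integrable (\<lambda>x. cnj (Dx (u s) x))" for s
      by (intro square_integrable_cnj u_props)
    have int: "(E n has_integral F n b - F n a) {a..b}" for n
    proof (rule fundamental_theorem_of_calculus[OF ab])
      show "(F n has_vector_derivative E n s) (at s within {a..b})" for s
        unfolding F_def[abs_def] E_def
        using DERIV_add[OF energy_quotient_derivative[of "d n" s] quartic_derivative[of s]]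
        by (auto simp: has_real_derivative_iff_has_vector_derivative intro: has_vector_derivative_at_within)
    qed
    \<comment> \<open>Uniform in n because the quotient of \<open>nonlin\<close> is bounded in L^2
      by its derivative; each of the two terms contributes 2 of the 4.\<close>
    have bound: "norm (E n s) \<le> 4 * (H1norm (nonlin s) * H1norm (u s))" for n s
    proof -
      have CS: "cmod (LINT x|lborel. g x * cnj (Dx (u s) x)) \<le> H1norm (nonlin s) * H1norm (u s)"
        if "square_integrable g" "L2norm g \<le> L2norm (Dx (nonlin s))" for g
      proof -
        have "cmod (LINT x|lborel. g x * cnj (Dx (u s) x)) \<le> L2norm g * L2norm (\<lambda>x. cnj (Dx (u s) x))"
          by (intro Cauchy_Schwarz_L2 that sq)
        also have "\<dots> \<le> H1norm (nonlin s) * H1norm (u s)"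
          using that(2) L2norm_le_H1norm(2)[of "nonlin s"] L2norm_le_H1norm(2)[of "u s"]
          by (intro mult_mono) (auto simp: L2norm_cnj)
        finally show ?thesis .
      qed
      define A where "A = (LINT x|lborel. diffq (d n) (nonlin s) x * cnj (Dx (u s) x))"
      define B where "B = (LINT x|lborel. Dx (nonlin s) x * cnj (Dx (u s) x))"
      have "cmod A \<le> H1norm (nonlin s) * H1norm (u s)" unfolding A_def
        by (intro CS square_integrable_diffq nonlin_props L2norm_diffq_le nonlin_H1 d)
      moreover have "cmod B \<le> H1norm (nonlin s) * H1norm (u s)" unfolding B_def
        by (intro CS nonlin_props) simp
      moreover have "\<bar>E n s\<bar> \<le> 2 * cmod A + 2 * cmod B"
        unfolding E_def A_def[symmetric] B_def[symmetric]
        using abs_Im_le_cmod[of A] abs_Im_le_cmod[of B] by simp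
      ultimately show ?thesis by simp
    qed
    have lim: "(\<lambda>n. E n s) \<longlonglongrightarrow> 0" for s
    proof -
      have "(\<lambda>n. E n s) \<longlonglongrightarrow> - 2 * Re (\<i> * (LINT x|lborel. Dx (nonlin s) x * cnj (Dx (u s) x))) +
       2 * Re (\<i> * (LINT x|lborel. Dx (nonlin s) x * cnj (Dx (u s) x)))"
        unfolding E_def d_def by (intro tendsto_intros diffq_tendsto_Dx_weakly nonlin_H1 sq)
      then show ?thesis by simp
    qed
    have "((\<lambda>s. 0) has_integral dnls_energy \<epsilon> (u b) - dnls_energy \<epsilon> (u a)) {a..b}"
    proof (rule has_integral_dominated_convergence[OF int])
      show "(\<lambda>s. 4 * (H1norm (nonlin s) * H1norm (u s))) integrable_on {a..b}"
        by (intro integrable_continuous_interval continuous_intros H1norm_u_continuous H1norm_nonlin_continuous)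
      show "(\<lambda>n. F n b - F n a) \<longlonglongrightarrow> dnls_energy \<epsilon> (u b) - dnls_energy \<epsilon> (u a)"
        unfolding F_def energy_eq d_def by (intro tendsto_intros energy_quotient_tendsto)
    qed (use bound lim in auto)
    then show ?thesis by simp
  qed
  show ?thesis by (metis le linear)
qed

section \<open>The mass current and weighted masses\<close>

text \<open>Formally the current j in the local conservation law \<partial>_t |u|^2 + \<partial>_x j
  = 0 of the mass. A weight \<omega> therefore moves at rate \<integral> \<omega>' j, and the weight
  x at rate \<integral> j.\<close>

definition momentum_flux :: "real \<Rightarrow> real \<Rightarrow> real" where
  "momentum_flux t x = 2 * Im (cnj (u t x) * Dx (u t) x) - 3 / 2 * \<epsilon> * (cmod (u t x)) ^ 4"

lemma integrable_cnj_u_Dx: "integrable lborel (\<lambda>x. cnj (u t x) * Dx (u t) x)"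
  by (intro integrable_mult_L2 square_integrable_cnj u_props)

lemma integrable_momentum_flux: "integrable lborel (momentum_flux t)"
  unfolding momentum_flux_def[abs_def]
  by (intro Bochner_Integration.integrable_diff integrable_mult_right integrable_Im
      integrable_cnj_u_Dx integrable_quartic)

lemma integral_momentum_flux:
  "(LINT x|lborel. momentum_flux t x) = - 2 * dnls_energy \<epsilon> (u t) - \<epsilon> / 2 * quartic t"
  unfolding momentum_flux_def energy_eq
  using integrable_cnj_u_Dx[of t] integrable_quartic[of t]
  by (simp add: quartic_def integral_Im del: cnj.sel complex_cnj_mult times_complex.sel)

text \<open>The right-hand side is continuous in time, so it can serve as the dominating function
  when the weights are removed under a time integral.\<close>

lemma integral_norm_momentum_flux_le:
  "(LINT x|lborel. \<bar>momentum_flux t x\<bar>) \<le> 2 * (H1norm (u t))\<^sup>2 + 3 / 2 * (H1norm (nonlin t) * H1norm (u t))"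
proof -
  have "(LINT x|lborel. \<bar>momentum_flux t x\<bar>) \<le>
    (LINT x|lborel. 2 * (cmod (u t x) * cmod (Dx (u t) x)) + 3 / 2 * (cmod (nonlin t x) * cmod (u t x)))"
  proof (rule integral_mono)
    show "\<bar>momentum_flux t x\<bar> \<le> 2 * (cmod (u t x) * cmod (Dx (u t) x)) + 3 / 2 * (cmod (nonlin t x) * cmod (u t x))" for x
    proof -
      have "cmod (nonlin t x) * cmod (u t x) = cmod (nonlin t x * cnj (u t x))" by (simp add: norm_mult)
      also have "\<dots> = \<bar>\<epsilon> * (cmod (u t x)) ^ 4\<bar>" unfolding nonlin_cnj_u by (rule norm_of_real)
      finally have "\<bar>\<epsilon> * (cmod (u t x)) ^ 4\<bar> = cmod (nonlin t x) * cmod (u t x)" ..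
      moreover have "\<bar>Im (cnj (u t x) * Dx (u t) x)\<bar> \<le> cmod (u t x) * cmod (Dx (u t) x)"
        using abs_Im_le_cmod[of "cnj (u t x) * Dx (u t) x"] by (simp only: norm_mult complex_mod_cnj)
      ultimately show ?thesis unfolding momentum_flux_def by linarith
    qed
  qed (auto intro!: integrable_momentum_flux integrable_mult_right integrable_mult_cmod u_props nonlin_props)
  also have "\<dots> = 2 * (LINT x|lborel. cmod (u t x) * cmod (Dx (u t) x)) +
      3 / 2 * (LINT x|lborel. cmod (nonlin t x) * cmod (u t x))"
    using integrable_mult_cmod[OF u_props(2,3), of t t] integrable_mult_cmod[OF nonlin_props(2) u_props(2), of t t]
    by simp
  also have "\<dots> \<le> 2 * (H1norm (u t) * H1norm (u t)) + 3 / 2 * (H1norm (nonlin t) * H1norm (u t))"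
  proof (intro add_mono mult_left_mono)
    show "(LINT x|lborel. cmod (u t x) * cmod (Dx (u t) x)) \<le> H1norm (u t) * H1norm (u t)"
      by (rule order_trans[OF Cauchy_Schwarz_cmod[OF u_props(2,3)] mult_mono]) (auto intro: L2norm_le_H1norm)
    show "(LINT x|lborel. cmod (nonlin t x) * cmod (u t x)) \<le> H1norm (nonlin t) * H1norm (u t)"
      by (rule order_trans[OF Cauchy_Schwarz_cmod[OF nonlin_props(2) u_props(2)] mult_mono]) (auto intro: L2norm_le_H1norm)
  qed auto
  finally show ?thesis by (simp add: power2_eq_square)
qed

text \<open>A real weight keeps the quadratic form symmetric, so
  \<open>functional_derivative\<close> applies with the sum of the values at s and t. The terms of
  the resulting integrand that carry \<omega> undifferentiated are either purely imaginary or
  absorbed by an exact derivative.\<close>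

lemma weighted_mass_derivative:
  assumes \<omega>: "\<omega> \<in> smooth_H1" "\<And>x. cnj (\<omega> x) = \<omega> x"
  shows "((\<lambda>s. Re (LINT x|lborel. u s x * (\<omega> x * cnj (u s x)))) has_real_derivative
     (LINT x|lborel. Re (Dx \<omega> x) * momentum_flux t x)) (at t)"
proof -
  define \<Phi> where "\<Phi> s x = \<omega> x * (cnj (u s x) + cnj (u t x))" for s x
  note \<omega>' = smooth_H1D[OF \<omega>(1)]
  have \<Phi>: "H1_continuous_at \<Phi> t"
    unfolding \<Phi>_def[abs_def]
    by (intro H1_continuous_at_add H1_continuous_at_mult H1_continuous_at_cnj
        u_continuous H1_continuous_at_const u_H1 smooth_H1_cnj \<omega>(1))
  note \<Phi>' = smooth_H1D[OF H1_continuous_atD(1)[OF \<Phi>]]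
  have D\<omega>: "cnj (Dx \<omega> x) = Dx \<omega> x" for x
  proof -
    have "(\<lambda>x. cnj (\<omega> x)) = \<omega>" using \<omega>(2) by blast
    then show ?thesis using fun_cong[OF Dx_cnj[OF \<omega>'(1)], of x] by metis
  qed
  have Im0: "Im (\<omega> x) = 0" "Im (Dx \<omega> x) = 0" for x
    using \<omega>(2)[of x] D\<omega>[of x] by (auto simp: complex_eq_iff)
  have sqv: "square_integrable (\<lambda>x. \<omega> x * cnj (u s x))" for s
    by (intro smooth_H1D(2)[OF smooth_H1_mult(1)] \<omega>(1) smooth_H1_cnj u_H1)
  have F: "Re (LINT x|lborel. u s x * (\<omega> x * cnj (u s x))) - Re (LINT x|lborel. u t x * (\<omega> x * cnj (u t x)))
     = Re (LINT x|lborel. (u s x - u t x) * \<Phi> s x)" for s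
  proof -
    have int: "integrable lborel (\<lambda>x. (u s x - u t x) * \<Phi> s x)"
      "integrable lborel (\<lambda>x. u a x * (\<omega> x * cnj (u a x)))" for a
      by (intro integrable_mult_L2 square_integrable_diff u_props \<Phi>' sqv)+
    have pt: "Re ((u s x - u t x) * \<Phi> s x) = Re (u s x * (\<omega> x * cnj (u s x))) - Re (u t x * (\<omega> x * cnj (u t x)))" for x
      using Im0(1)[of x] by (simp add: \<Phi>_def algebra_simps)
    show ?thesis
      unfolding integral_Re[OF int(1), symmetric] integral_Re[OF int(2), symmetric] pt
      by (rule Bochner_Integration.integral_diff[symmetric]; intro integrable_Re int)
  qed
  \<comment> \<open>\<omega> |u|^4: subtracting \<epsilon>/2 times its derivative, which integrates
    to zero, removes the undifferentiated weight and lowers the quartic coefficient of \<omega>'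
    from 2 to 3/2.\<close>
  define P where "P x = \<omega> x * ((u t x * cnj (u t x)) * (u t x * cnj (u t x)))" for x
  have P: "smooth P" unfolding P_def[abs_def] by (intro smooth_mult smooth_cnj u_props \<omega>')
  have H1Q: "(\<lambda>x. u t x * cnj (u t x)) \<in> smooth_H1"
    by (intro smooth_H1_mult smooth_H1_cnj u_H1)
  have DQ: "Dx (\<lambda>x. u t x * cnj (u t x)) = (\<lambda>x. u t x * cnj (Dx (u t) x) + Dx (u t) x * cnj (u t x))"
    by (simp add: Dx_mult Dx_cnj smooth_cnj u_props)
  have DP': "Dx P = (\<lambda>x. \<omega> x * Dx (\<lambda>x. (u t x * cnj (u t x)) * (u t x * cnj (u t x))) x
     + Dx \<omega> x * ((u t x * cnj (u t x)) * (u t x * cnj (u t x))))"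
    unfolding P_def[abs_def] by (intro Dx_mult smooth_mult smooth_cnj u_props \<omega>')
  have DP: "Dx P = (\<lambda>x. \<omega> x * (2 * (u t x * cnj (u t x)) * (u t x * cnj (Dx (u t) x) + Dx (u t) x * cnj (u t x)))
      + Dx \<omega> x * ((u t x * cnj (u t x)) * (u t x * cnj (u t x))))"
  proof -
    have "Dx (\<lambda>x. (u t x * cnj (u t x)) * (u t x * cnj (u t x))) =
      (\<lambda>x. 2 * (u t x * cnj (u t x)) * (u t x * cnj (Dx (u t) x) + Dx (u t) x * cnj (u t x)))"
      using Dx_mult[OF smooth_H1D(1)[OF H1Q] smooth_H1D(1)[OF H1Q]] unfolding DQ
      by (simp add: algebra_simps)
    then show ?thesis unfolding DP' by simp
  qed
  have P_int: "integrable lborel P" "integrable lborel (Dx P)"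
  proof -
    show "integrable lborel P"
      unfolding P_def[abs_def]
      by (intro integrable_mult_L2 \<omega>' smooth_H1D(2)[OF smooth_H1_mult(1)] H1Q)
    show "integrable lborel (Dx P)"
      unfolding DP'
      by (intro Bochner_Integration.integrable_add integrable_mult_L2 \<omega>' smooth_H1D(2,3)[OF smooth_H1_mult(1)] H1Q)
  qed
  have D\<Phi>: "Dx (\<Phi> t) = (\<lambda>x. 2 * (\<omega> x * cnj (Dx (u t) x) + Dx \<omega> x * cnj (u t x)))"
  proof -
    have "\<Phi> t = (\<lambda>x. 2 * (\<omega> x * cnj (u t x)))"
      by (simp add: \<Phi>_def fun_eq_iff)
    then have "Dx (\<Phi> t) = (\<lambda>x. 2 * Dx (\<lambda>x. \<omega> x * cnj (u t x)) x)"
      by (simp only: Dx_cmult smooth_cnj smooth_mult u_props \<omega>')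
    then show ?thesis by (simp add: Dx_mult Dx_cnj smooth_cnj u_props \<omega>')
  qed
  have pt: "- Re (flux t x * Dx (\<Phi> t) x) = Re (Dx \<omega> x) * momentum_flux t x - \<epsilon> / 2 * Re (Dx P x)" for x
  proof -
    have c4: "cmod z ^ 4 = ((Re z)\<^sup>2 + (Im z)\<^sup>2)\<^sup>2" for z
      unfolding cmod_power2[symmetric] by (simp flip: power_mult)
    show ?thesis
      unfolding D\<Phi> DP flux_def nonlin_def momentum_flux_def c4
      by (simp add: Im0 power2_eq_square) (simp add: field_simps)
  qed
  have int: "integrable lborel (\<lambda>x. flux t x * Dx (\<Phi> t) x)"
    by (intro integrable_mult_L2 flux_L2 \<Phi>')
  have int1: "integrable lborel (\<lambda>x. Re (Dx \<omega> x) * momentum_flux t x)"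
  proof -
    have "(\<lambda>x. Re (Dx \<omega> x) * momentum_flux t x) = (\<lambda>x. - Re (flux t x * Dx (\<Phi> t) x) + \<epsilon> / 2 * Re (Dx P x))"
      unfolding pt by simp
    then show ?thesis using int P_int by (simp only: Bochner_Integration.integrable_add integrable_mult_right
          Bochner_Integration.integrable_minus integrable_Re)
  qed
  have "- Re (LINT x|lborel. flux t x * Dx (\<Phi> t) x) = (LINT x|lborel. - Re (flux t x * Dx (\<Phi> t) x))"
    unfolding integral_Re[OF int, symmetric] by (rule Bochner_Integration.integral_minus[symmetric])
  also have "\<dots> = (LINT x|lborel. Re (Dx \<omega> x) * momentum_flux t x) - \<epsilon> / 2 * Re (LINT x|lborel. Dx P x)"
    unfolding pt integral_Re[OF P_int(2), symmetric] using int1 integrable_Re[OF P_int(2)]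
    by (simp del: integral_Re)
  also have "(LINT x|lborel. Dx P x) = 0"
    by (rule integral_Dx_eq_0[OF P P_int])
  finally show ?thesis using functional_derivative[OF \<Phi> F] by simp
qed

end

section \<open>Periodic solutions\<close>


context dnls_flow
begin

text \<open>For each n the truncated first moment takes equal values at both ends of the period, so
  the time integral is exactly 0 before any limit. Two dominated limits follow, in x at fixed time
  and then in time.\<close>

lemma integral_momentum_flux_over_period:
  assumes \<tau>: "\<tau> > 0" "\<And>t x. u (t + \<tau>) x = u t x"
  shows "((\<lambda>t. LINT x|lborel. momentum_flux t x) has_integral 0) {a..a + \<tau>}"
proof -
  obtain B where B: "B \<ge> 1" "\<And>n x. cmod (cutoff n x) \<le> B" "\<And>n x. cmod (Dx (cutoff n) x) \<le> B"
    "\<And>n x. cmod (x * Dx (cutoff n) x) \<le> B"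
    using cutoff_bounds by blast
  define \<omega> where "\<omega> n x = of_real x * cutoff n x" for n x
  have \<omega>_smooth: "smooth (\<omega> n)" for n
    unfolding \<omega>_def[abs_def] by (intro smooth_mult smooth_of_real smooth_cutoff)
  have \<omega>_H1: "\<omega> n \<in> smooth_H1" for n
    by (rule compact_support_smooth_H1[OF \<omega>_smooth, of "real (Suc n)"]) (simp add: \<omega>_def cutoff_eq_0 del: of_nat_Suc)
  have \<omega>_real: "cnj (\<omega> n x) = \<omega> n x" for n x
    by (simp add: \<omega>_def cutoff_def bump_def flat_def exp_cnj)
  have "Dx complex_of_real = (\<lambda>x. 1)"
    by (intro ext Dx_eqI)
      (use bounded_linear.has_vector_derivative[OF bounded_linear_of_real has_vector_derivative_id] in simp)
  then have D\<omega>: "Dx (\<omega> n) x = of_real x * Dx (cutoff n) x + cutoff n x" for n x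
    unfolding \<omega>_def[abs_def] by (simp add: Dx_mult smooth_of_real smooth_cutoff)
  \<comment> \<open>Each of the two product-rule terms is at most B, the one containing x by the
    scale-invariant bound on the cutoffs.\<close>
  have D\<omega>_le: "\<bar>Re (Dx (\<omega> n) x)\<bar> \<le> 2 * B" for n x
  proof -
    have "cmod (Dx (\<omega> n) x) \<le> B + B"
      unfolding D\<omega> by (intro norm_triangle_le add_mono B)
    then show ?thesis using abs_Re_le_cmod[of "Dx (\<omega> n) x"] by linarith
  qed
  have D\<omega>_lim: "(\<lambda>n. Re (Dx (\<omega> n) x)) \<longlonglongrightarrow> 1" for x
  proof -
    have "(\<lambda>n. Re (Dx (\<omega> n) x)) \<longlonglongrightarrow> Re (0 + 1)"
      unfolding D\<omega> by (intro tendsto_intros mult_Dx_cutoff_tendsto cutoff_tendsto)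
    then show ?thesis by simp
  qed
  have D\<omega>_borel [measurable]: "(\<lambda>x. Re (Dx (\<omega> n) x)) \<in> borel_measurable borel" for n
    using smooth_H1D(6)[OF \<omega>_H1] by measurable
  note [measurable] = borel_measurable_integrable[OF integrable_momentum_flux, simplified]
  define E where "E n t = (LINT x|lborel. Re (Dx (\<omega> n) x) * momentum_flux t x)" for n t
  have int_bound: "integrable lborel (\<lambda>x. 2 * B * \<bar>momentum_flux t x\<bar>)" for t
    using integrable_momentum_flux by (intro integrable_mult_right integrable_abs)
  have pt: "norm (Re (Dx (\<omega> n) x) * momentum_flux t x) \<le> 2 * B * \<bar>momentum_flux t x\<bar>" for n t x
    using D\<omega>_le[of n x] by (simp add: abs_mult mult_right_mono)
  have E_int: "(E n has_integral 0) {a..a + \<tau>}" for n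
  proof -
    define F where "F s = Re (LINT x|lborel. u s x * (\<omega> n x * cnj (u s x)))" for s
    have "(E n has_integral F (a + \<tau>) - F a) {a..a + \<tau>}"
    proof (rule fundamental_theorem_of_calculus)
      show "(F has_vector_derivative E n s) (at s within {a..a + \<tau>})" for s
        using weighted_mass_derivative[OF \<omega>_H1 \<omega>_real, of n s] unfolding F_def[abs_def] E_def
        by (auto simp: has_real_derivative_iff_has_vector_derivative intro: has_vector_derivative_at_within)
    qed (use \<tau> in simp)
    then show ?thesis by (simp add: F_def \<tau>)
  qed
  have E_lim: "(\<lambda>n. E n t) \<longlonglongrightarrow> (LINT x|lborel. momentum_flux t x)" for t
    unfolding E_def
  proof (rule integral_dominated_convergence[OF _ _ int_bound])
    have "(\<lambda>n. Re (Dx (\<omega> n) x) * momentum_flux t x) \<longlonglongrightarrow> 1 * momentum_flux t x" for x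
      by (intro tendsto_intros D\<omega>_lim)
    then show "AE x in lborel. (\<lambda>n. Re (Dx (\<omega> n) x) * momentum_flux t x) \<longlonglongrightarrow> momentum_flux t x" by simp
  qed (use pt in auto)
  define h where "h t = 2 * B * (2 * (H1norm (u t))\<^sup>2 + 3 / 2 * (H1norm (nonlin t) * H1norm (u t)))" for t
  have E_le: "norm (E n t) \<le> h t" for n t
  proof -
    have "norm (E n t) \<le> (LINT x|lborel. norm (Re (Dx (\<omega> n) x) * momentum_flux t x))"
      unfolding E_def by (rule integral_norm_bound)
    also have "\<dots> \<le> (LINT x|lborel. 2 * B * \<bar>momentum_flux t x\<bar>)"
    proof (rule integral_mono[OF _ int_bound pt])
      show "integrable lborel (\<lambda>x. norm (Re (Dx (\<omega> n) x) * momentum_flux t x))"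
        by (rule Bochner_Integration.integrable_bound[OF int_bound[of t]]) (use pt[of n _ t] in \<open>auto simp: order_trans[OF _ abs_ge_self]\<close>)
    qed
    also have "\<dots> = 2 * B * (LINT x|lborel. \<bar>momentum_flux t x\<bar>)" by simp
    also have "\<dots> \<le> h t"
      unfolding h_def using B(1) by (intro mult_left_mono integral_norm_momentum_flux_le) simp
    finally show ?thesis .
  qed
  show ?thesis
  proof (rule has_integral_dominated_convergence[OF E_int])
    show "h integrable_on {a..a + \<tau>}"
      unfolding h_def by (intro integrable_continuous_interval continuous_intros H1norm_u_continuous H1norm_nonlin_continuous)
  qed (use E_le E_lim in auto)
qed

lemma quartic_eq_0_imp:
  assumes "quartic t = 0"
  shows "u t x = 0"
proof -
  define f where "f y = (cmod (u t y)) ^ 4" for y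
  have c: "continuous_on A f" for A
    unfolding f_def by (intro continuous_intros smooth_continuous u_props)
  have f_int: "integrable lborel f" unfolding f_def[abs_def] by (rule integrable_quartic)
  have AE: "AE y in lborel. f y = 0"
  proof (rule integral_nonneg_eq_0_iff_AE[OF f_int, THEN iffD1])
    show "(LINT y|lborel. f y) = 0" using assms by (simp add: quartic_def f_def)
  qed (simp add: f_def)
  \<comment> \<open>Vanishing almost everywhere becomes vanishing at x: a continuous nonnegative
    function with zero integral over an interval around x is zero there.\<close>
  have "set_integrable lborel {x - 1..x + 1} f"
    by (rule borel_integrable_atLeastAtMost'[OF c])
  then have "(f has_integral (LINT y:{x - 1..x + 1}|lborel. f y)) {x - 1..x + 1}"
    using set_borel_integral_eq_integral[of "{x - 1..x + 1}" f] by (simp add: has_integral_integrable_integral)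
  moreover have "(LINT y:{x - 1..x + 1}|lborel. f y) = 0"
    unfolding set_lebesgue_integral_def using AE by (intro integral_eq_zero_AE) auto
  ultimately have "(f has_integral 0) (cbox (x - 1) (x + 1))" by simp
  then have "f x = 0"
    by (rule has_integral_0_cbox_imp_0[OF c, rotated]) (auto simp: f_def)
  then show ?thesis by (simp add: f_def)
qed

text \<open>The period may be started at any time a, so the pointwise conclusion from a zero
  integral is drawn at the left endpoint and covers all times.\<close>

theorem no_periodic_solution:
  assumes \<epsilon>: "\<epsilon> \<in> {1, -1}" and \<tau>: "\<tau> > 0" "\<And>t x. u (t + \<tau>) x = u t x"
    and H: "\<epsilon> * dnls_energy \<epsilon> (u t) \<ge> 0"
  shows "u a x = 0"
proof -
  \<comment> \<open>This is -\<epsilon> times the integrated mass current, with H taken at the fixed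
    time t by conservation. The factor \<epsilon> / 2 stays on \<open>quartic\<close> so that
    continuity in time can be read off \<open>quartic_derivative\<close>; since \<epsilon>^2 = 1 the
    last term is half of \<open>quartic\<close>.\<close>
  define g where "g s = 2 * (\<epsilon> * dnls_energy \<epsilon> (u t)) + \<epsilon> * (\<epsilon> / 2 * quartic s)" for s
  have \<epsilon>2: "\<epsilon> * \<epsilon> = 1" using \<epsilon> by auto
  have quartic_nonneg: "quartic s \<ge> 0" for s unfolding quartic_def by simp
  have g_eq: "g s = 2 * (\<epsilon> * dnls_energy \<epsilon> (u t)) + quartic s / 2" for s
    using \<epsilon>2 by (simp add: g_def mult.assoc[symmetric])
  have "(LINT x|lborel. momentum_flux s x) * (- \<epsilon>) = g s" for s
    unfolding integral_momentum_flux g_def energy_conservation[of s t] by (simp add: algebra_simps)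
  then have int: "(g has_integral 0) (cbox a (a + \<tau>))"
    using has_integral_mult_left[OF integral_momentum_flux_over_period[OF \<tau>, of a], of "- \<epsilon>"] by simp
  have "isCont g s" for s
    unfolding g_def
    by (intro continuous_add[OF continuous_const continuous_mult_left] DERIV_isCont[OF quartic_derivative])
  then have "continuous_on (cbox a (a + \<tau>)) g"
    by (simp add: continuous_at_imp_continuous_on)
  then have "g a = 0"
    by (rule has_integral_0_cbox_imp_0[OF _ _ int]) (use \<tau> H quartic_nonneg in \<open>auto simp: g_eq\<close>)
  then have "quartic a = 0"
    using H quartic_nonneg[of a] by (simp add: g_eq)
  then show ?thesis by (rule quartic_eq_0_imp)
qed

end

theorem theorem4p5:
  fixes \<epsilon> :: real
  assumes "\<epsilon> \<in> {1, -1}"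
  shows "\<not> (\<exists>u t. dnls_breather \<epsilon> u \<and>
           ((\<epsilon> = -1 \<and> dnls_energy \<epsilon> (u t) \<le> 0) \<or> (\<epsilon> = 1 \<and> dnls_energy \<epsilon> (u t) \<ge> 0)))"
proof
  assume "\<exists>u t. dnls_breather \<epsilon> u \<and>
           ((\<epsilon> = -1 \<and> dnls_energy \<epsilon> (u t) \<le> 0) \<or> (\<epsilon> = 1 \<and> dnls_energy \<epsilon> (u t) \<ge> 0))"
  \<comment> \<open>Multiplying by \<epsilon> merges the two regimes into one inequality.\<close>
  then obtain u t where u: "dnls_breather \<epsilon> u" and H: "\<epsilon> * dnls_energy \<epsilon> (u t) \<ge> 0"
    by auto
  from u obtain \<tau> where sol: "dnls_solution \<epsilon> u" and nz: "\<exists>t x. u t x \<noteq> 0"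
    and \<tau>: "\<tau> > 0" "\<And>t x. u (t + \<tau>) x = u t x"
    unfolding dnls_breather_def by blast
  interpret dnls_flow \<epsilon> u by unfold_locales (rule sol)
  show False using no_periodic_solution[OF assms \<tau> H] nz by blast
qed

end
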